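(* Let $\sigma$ be a finite or countable signature, $\psi$ a strictly limited e-complexity measure over $\sigma$ for which $K_\psi$ is a total recursive function, $C$ a nonempty class of structures of $\sigma$, and $H$ a nonempty subset of $H^{=}(\sigma)$. If the problem of solvability for the quadruple $(\mathrm{Probl}^{=}(\sigma),\mathrm{Tree}^{=}(\sigma),H,C)$ is decidable, then the problem of e-optimization for the triple $(\psi,H,C)$ is decidable.
   Context: Notation: $\omega=\{0,1,2,\dots\}$, $E_2=\{0,1\}$, variables $X=\{x_i:i\in\omega\}$, $X_n=\{x_0,\dots,x_{n-1}\}$; $\alpha^1=\alpha$, $\alpha^0=\neg\alpha$. The signature $\sigma$ (predicate and function symbols with arities) is written $\{q_1,\dots,q_m\}$ or $\{q_1,q_2,\dots\}$; $\sigma_==\sigma\cup\{q_0\}$ where $q_0$ denotes equality; $\sigma_=^*$ is the set of finite words over $\sigma_=$ including the empty word $\lambda$. An e-complexity measure is $\psi:\sigma_=^*\to\omega$; it is strictly limited if computable and $\psi(\alpha_1\alpha_2\alpha_3)>\psi(\alpha_1\alpha_3)$ for all $\alpha_1,\alpha_2,\alpha_3\in\sigma_=^*$ with $\alpha_2\ne\lambda$. For $i\in\omega$, $\omega_\psi(i)=\{q_j\in\sigma_=:\psi(q_j)=i\}$; $K_\psi$ is the partial function $\omega\to\omega$ with $K_\psi(i)=|\omega_\psi(i)|$ if finite, undefined otherwise. A function expression is $x_j\Leftarrow f(x_{l_1},\dots,x_{l_m})$; a predicate expression is $x_{l_1}=x_{l_2}$ or $r(x_{l_1},\dots,x_{l_k})$.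 For $n\ge1$ and a sequence $\beta=\beta_1,\dots,\beta_m$ define term sequences $M_i=(t_{i0},t_{i1},\dots)$: $M_1=(x_0,\dots,x_{n-1},x_{n-1},\dots)$; $M_{i+1}=M_i$ if $\beta_i$ is a predicate expression; if $\beta_i$ is $x_j\Leftarrow f(x_{l_1},\dots,x_{l_m})$, $M_{i+1}$ is $M_i$ with $t_{ij}$ replaced by $f(t_{il_1},\dots,t_{il_m})$. For predicate $\beta_i$, $\kappa(n,\beta,\beta_i)$ is $t_{il_1}=t_{il_2}$ or $r(t_{il_1},\dots,t_{il_k})$ respectively. $\mathrm{word}(\beta)=q_{i_1}\cdots q_{i_m}\in\sigma_=^*$ where $q_{i_j}$ is the symbol of $\sigma_=$ in $\beta_j$ ($q_0$ for $x_{l_1}=x_{l_2}$). $\mathrm{Tree}^{=}(\sigma)$: schemes $S=(n,G)$, $n\ge1$, $G$ a finite rooted directed tree with function nodes (function expression, one outgoing edge), predicate nodes (predicate expression, two outgoing edges labeled $0,1$), terminal nodes (labeled by numbers in $\omega$). For a complete path $\tau=w_1,d_1,\dots,w_m,d_m,w_{m+1}$ with expressions $\beta_\tau$, $F(\tau)$ is the set of $\kappa(n,\beta_\tau,\beta_i)^c$ for predicate nodes $w_i$, $c$ the label of $d_i$ (a tautology if none), $t_\tau$ the terminal label. For a structure $U$ with universe $A$, $\varphi_{(S,U)}(\bar a)=t_\tau$ for the unique complete path $\tau$ with all of $F(\tau)$ true in $U$ on $\bar a\in A^n$. $\psi(S)=\max_\tau\psi(\mathrm{word}(\beta_\tau))$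 over complete paths. $\mathrm{Probl}^{=}(\sigma)$: schemes $s=(n,\nu,\beta_1,\dots,\beta_m)$, $n,m\ge1$, with exactly $k\ge1$ predicate expressions $\beta_{i_1},\dots,\beta_{i_k}$, $\nu:E_2^k\to\omega$; with $\alpha_j=\kappa(n,\beta,\beta_{i_j})$, $\varphi_{(s,U)}(\bar a)=\nu(\alpha_1(\bar a),\dots,\alpha_k(\bar a))$. $S=(n_1,G)$ solves $s=(n_2,\dots)$ relative to class $C$ if $n_1=n_2$ and either $C=\emptyset$ or $\varphi_{(S,U)}=\varphi_{(s,U)}$ for all $U\in C$. $H^{=}(\sigma)$: all sentences of $\sigma$; $C(\alpha)=\{U\in C:U\models\alpha\}$. Problem of solvability for $(\mathrm{Probl}^{=}(\sigma),\mathrm{Tree}^{=}(\sigma),H,C)$: given $\alpha\in H$, $s$, $S$, decide whether $S$ solves $s$ relative to $C(\alpha)$. Problem of e-optimization for $(\psi,H,C)$: given $\alpha\in H$ and $s\in\mathrm{Probl}^{=}(\sigma)$, find $S\in\mathrm{Tree}^{=}(\sigma)$ solving $s$ relative to $C(\alpha)$ with minimum $\psi(S)$ among such schemes. Decidable means solvable by an algorithm.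
   Formalization: For an infinite signature it is additionally assumed that the kind (function or predicate) and arity of q_j are computable from j, without which the claim can fail; the class C is taken as a set of structures whose universes lie in one arbitrary common set. *)

theory Defs
  imports Main "HOL-Library.Nat_Bijection"
begin

section \<open>Partial recursive functions\<close>

datatype recf =
    Zero
  | Succ
  | Proj nat
  | Comp recf "recf list"
  | PrimRec recf recf
  | Mu recf

text \<open>\<open>computes f xs y\<close>: the partial recursive function described by \<open>f\<close> is defined on the
  argument tuple \<open>xs\<close> and has the value \<open>y\<close> there. The recursion argument of \<open>PrimRec\<close> and the
  search argument of \<open>Mu\<close> come first; in \<open>PrimRec f g\<close> the step function \<open>g\<close> receives the
  counter, the previous value and the parameters, in this order.\<close>

inductive computes :: "recf \<Rightarrow> nat list \<Rightarrow> nat \<Rightarrow> bool" where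
  computes_Zero: "computes Zero xs 0"
| computes_Succ: "computes Succ [x] (Suc x)"
| computes_Proj: "i < length xs \<Longrightarrow> computes (Proj i) xs (xs ! i)"
| computes_Comp: "list_all2 (\<lambda>g y. computes g xs y) gs ys \<Longrightarrow> computes f ys z \<Longrightarrow>
    computes (Comp f gs) xs z"
| computes_PrimRec_0: "computes f xs y \<Longrightarrow> computes (PrimRec f g) (0 # xs) y"
| computes_PrimRec_Suc: "computes (PrimRec f g) (n # xs) y \<Longrightarrow> computes g (n # y # xs) z \<Longrightarrow>
    computes (PrimRec f g) (Suc n # xs) z"
| computes_Mu: "computes f (n # xs) 0 \<Longrightarrow> (\<forall>m<n. \<exists>y. computes f (m # xs) (Suc y)) \<Longrightarrow>
    computes (Mu f) xs n"

inductive_cases computes_elims: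
  "computes Zero xs y" "computes Succ xs y" "computes (Proj i) xs y"
  "computes (Comp f gs) xs y" "computes (Mu f) xs y"
  "computes (PrimRec f g) (0 # xs) y" "computes (PrimRec f g) (Suc n # xs) y"

lemma computes_deterministic: "computes f xs y \<Longrightarrow> computes f xs z \<Longrightarrow> y = z"
proof (induction arbitrary: z rule: computes.induct)
  case (computes_Comp xs gs ys f z')
  from computes_Comp.prems obtain ys' where
    ys': "list_all2 (\<lambda>g y. computes g xs y) gs ys'" "computes f ys' z"
    by (rule computes_elims) auto
  have "ys = ys'"
  proof (rule nth_equalityI)
    show "length ys = length ys'"
      using list_all2_lengthD[OF computes_Comp.IH(1)] list_all2_lengthD[OF ys'(1)] by simp
    fix i assume i: "i < length ys"
    have "length gs = length ys" using list_all2_lengthD[OF computes_Comp.IH(1)] .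
    with i list_all2_nthD[OF computes_Comp.IH(1), of i] list_all2_nthD[OF ys'(1), of i]
    show "ys ! i = ys' ! i" by simp
  qed
  with ys'(2) computes_Comp.IH(2) show ?case by simp
next
  case (computes_PrimRec_Suc f g n xs y z')
  from computes_PrimRec_Suc.prems obtain y' where
    "computes (PrimRec f g) (n # xs) y'" "computes g (n # y' # xs) z"
    by (rule computes_elims) auto
  with computes_PrimRec_Suc.IH show ?case by blast
next
  case (computes_Mu f n xs)
  from computes_Mu.prems have z: "computes f (z # xs) 0" "\<forall>m<z. \<exists>y. computes f (m # xs) (Suc y)"
    by (blast elim: computes_elims(5))+
  show ?case
  proof (rule linorder_cases[of n z])
    assume "n < z"
    with z(2) obtain y where "computes f (n # xs) (Suc y)" by blast
    with computes_Mu.IH(1) have "0 = Suc y" by blast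
    then show ?thesis by simp
  next
    assume "z < n"
    with computes_Mu.IH(2) obtain y where "\<forall>v. computes f (z # xs) v \<longrightarrow> Suc y = v" by blast
    with z(1) have "Suc y = 0" by blast
    then show ?thesis by simp
  qed simp
qed (erule computes_elims; simp)+


section \<open>Signatures, first-order formulas, structures\<close>

text \<open>A symbol is represented by its index: \<open>j\<close> stands for \<open>q\<^sub>j\<close>, and \<open>0\<close> is reserved for
  equality. Symbols of arity \<open>0\<close> are permitted.\<close>

record fo_signature =
  syms :: "nat set"
  is_fun :: "nat \<Rightarrow> bool"
  arity :: "nat \<Rightarrow> nat"

definition syms_eq :: "fo_signature \<Rightarrow> nat set" where
  "syms_eq \<sigma> = insert 0 (syms \<sigma>)"

text \<open>The last two conditions say that the kind and the arity of \<open>q\<^sub>j\<close> can be found from \<open>j\<close>;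
  they hold automatically if \<open>\<sigma>\<close> is finite. For an infinite signature some such condition is
  implicit in letting algorithms produce expressions over \<open>\<sigma>\<close>.\<close>

definition effective_signature :: "fo_signature \<Rightarrow> bool" where
  "effective_signature \<sigma> \<longleftrightarrow>
     ((\<exists>m. syms \<sigma> = {1..m}) \<or> syms \<sigma> = {1..}) \<and>
     (\<exists>f. \<forall>j \<in> syms \<sigma>. computes f [j] (if is_fun \<sigma> j then 1 else 0)) \<and>
     (\<exists>f. \<forall>j \<in> syms \<sigma>. computes f [j] (arity \<sigma> j))"

definition fun_sym :: "fo_signature \<Rightarrow> nat \<Rightarrow> nat \<Rightarrow> bool" where
  "fun_sym \<sigma> f k \<longleftrightarrow> f \<in> syms \<sigma> \<and> is_fun \<sigma> f \<and> arity \<sigma> f = k"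

definition pred_sym :: "fo_signature \<Rightarrow> nat \<Rightarrow> nat \<Rightarrow> bool" where
  "pred_sym \<sigma> r k \<longleftrightarrow> r \<in> syms \<sigma> \<and> \<not> is_fun \<sigma> r \<and> arity \<sigma> r = k"

datatype trm = Var nat | Fn nat "trm list"

datatype fm =
    Eq trm trm
  | Rel nat "trm list"
  | Neg fm
  | And fm fm
  | Or fm fm
  | Imp fm fm
  | All nat fm
  | Ex nat fm

fun wf_trm :: "fo_signature \<Rightarrow> trm \<Rightarrow> bool" where
  "wf_trm \<sigma> (Var i) \<longleftrightarrow> True"
| "wf_trm \<sigma> (Fn f ts) \<longleftrightarrow> fun_sym \<sigma> f (length ts) \<and> (\<forall>t \<in> set ts. wf_trm \<sigma> t)"

primrec wf_fm :: "fo_signature \<Rightarrow> fm \<Rightarrow> bool" where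
  "wf_fm \<sigma> (Eq t u) \<longleftrightarrow> wf_trm \<sigma> t \<and> wf_trm \<sigma> u"
| "wf_fm \<sigma> (Rel r ts) \<longleftrightarrow> pred_sym \<sigma> r (length ts) \<and> (\<forall>t \<in> set ts. wf_trm \<sigma> t)"
| "wf_fm \<sigma> (Neg p) \<longleftrightarrow> wf_fm \<sigma> p"
| "wf_fm \<sigma> (And p q) \<longleftrightarrow> wf_fm \<sigma> p \<and> wf_fm \<sigma> q"
| "wf_fm \<sigma> (Or p q) \<longleftrightarrow> wf_fm \<sigma> p \<and> wf_fm \<sigma> q"
| "wf_fm \<sigma> (Imp p q) \<longleftrightarrow> wf_fm \<sigma> p \<and> wf_fm \<sigma> q"
| "wf_fm \<sigma> (All i p) \<longleftrightarrow> wf_fm \<sigma> p"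
| "wf_fm \<sigma> (Ex i p) \<longleftrightarrow> wf_fm \<sigma> p"

primrec vars_trm :: "trm \<Rightarrow> nat set" where
  "vars_trm (Var i) = {i}"
| "vars_trm (Fn f ts) = \<Union> (set (map vars_trm ts))"

primrec free_vars :: "fm \<Rightarrow> nat set" where
  "free_vars (Eq t u) = vars_trm t \<union> vars_trm u"
| "free_vars (Rel r ts) = \<Union> (set (map vars_trm ts))"
| "free_vars (Neg p) = free_vars p"
| "free_vars (And p q) = free_vars p \<union> free_vars q"
| "free_vars (Or p q) = free_vars p \<union> free_vars q"
| "free_vars (Imp p q) = free_vars p \<union> free_vars q"
| "free_vars (All i p) = free_vars p - {i}"
| "free_vars (Ex i p) = free_vars p - {i}"

definition sentences :: "fo_signature \<Rightarrow> fm set" where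
  "sentences \<sigma> = {\<alpha>. wf_fm \<sigma> \<alpha> \<and> free_vars \<alpha> = {}}"

record 'a fo_struct =
  univ :: "'a set"
  fun_of :: "nat \<Rightarrow> 'a list \<Rightarrow> 'a"
  rel_of :: "nat \<Rightarrow> 'a list \<Rightarrow> bool"

definition tuples :: "'a set \<Rightarrow> nat \<Rightarrow> 'a list set" where
  "tuples A n = {as. length as = n \<and> set as \<subseteq> A}"

definition structures :: "fo_signature \<Rightarrow> 'a fo_struct set" where
  "structures \<sigma> = {U. univ U \<noteq> {} \<and>
     (\<forall>f k. fun_sym \<sigma> f k \<longrightarrow> (\<forall>as \<in> tuples (univ U) k. fun_of U f as \<in> univ U))}"

primrec eval_trm :: "'a fo_struct \<Rightarrow> (nat \<Rightarrow> 'a) \<Rightarrow> trm \<Rightarrow> 'a" where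
  "eval_trm U e (Var i) = e i"
| "eval_trm U e (Fn f ts) = fun_of U f (map (eval_trm U e) ts)"

primrec sat :: "'a fo_struct \<Rightarrow> (nat \<Rightarrow> 'a) \<Rightarrow> fm \<Rightarrow> bool" where
  "sat U e (Eq t u) \<longleftrightarrow> eval_trm U e t = eval_trm U e u"
| "sat U e (Rel r ts) \<longleftrightarrow> rel_of U r (map (eval_trm U e) ts)"
| "sat U e (Neg p) \<longleftrightarrow> \<not> sat U e p"
| "sat U e (And p q) \<longleftrightarrow> sat U e p \<and> sat U e q"
| "sat U e (Or p q) \<longleftrightarrow> sat U e p \<or> sat U e q"
| "sat U e (Imp p q) \<longleftrightarrow> (sat U e p \<longrightarrow> sat U e q)"
| "sat U e (All i p) \<longleftrightarrow> (\<forall>a \<in> univ U. sat U (e(i := a)) p)"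
| "sat U e (Ex i p) \<longleftrightarrow> (\<exists>a \<in> univ U. sat U (e(i := a)) p)"

definition models :: "'a fo_struct \<Rightarrow> fm \<Rightarrow> bool" where
  "models U \<alpha> \<longleftrightarrow> (\<forall>e. (\<forall>i. e i \<in> univ U) \<longrightarrow> sat U e \<alpha>)"

definition restrict_class :: "'a fo_struct set \<Rightarrow> fm \<Rightarrow> 'a fo_struct set" where
  "restrict_class C \<alpha> = {U \<in> C. models U \<alpha>}"

text \<open>For formulas in the variables \<open>x\<^sub>0, \<dots>, x\<^sub>n\<^sub>-\<^sub>1\<close> and an \<open>n\<close>-tuple \<open>as\<close>.\<close>

definition true_on :: "'a fo_struct \<Rightarrow> 'a list \<Rightarrow> fm \<Rightarrow> bool" where
  "true_on U as \<alpha> \<longleftrightarrow> sat U (\<lambda>i. as ! i) \<alpha>"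


section \<open>Expressions\<close>

text \<open>\<open>Assign j f ls\<close> is \<open>x\<^sub>j \<Leftarrow> q\<^sub>f(x\<^sub>l, \<dots>)\<close>, with \<open>ls\<close> the list of the argument indices.\<close>

datatype fun_expr = Assign nat nat "nat list"

datatype pred_expr = EqTest nat nat | RelTest nat "nat list"

datatype expr = FunX fun_expr | is_PredX: PredX (the_pred: pred_expr)

primrec wf_fun_expr :: "fo_signature \<Rightarrow> fun_expr \<Rightarrow> bool" where
  "wf_fun_expr \<sigma> (Assign j f ls) \<longleftrightarrow> fun_sym \<sigma> f (length ls)"

primrec wf_pred_expr :: "fo_signature \<Rightarrow> pred_expr \<Rightarrow> bool" where
  "wf_pred_expr \<sigma> (EqTest l l') \<longleftrightarrow> True"
| "wf_pred_expr \<sigma> (RelTest r ls) \<longleftrightarrow> pred_sym \<sigma> r (length ls)"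

primrec wf_expr :: "fo_signature \<Rightarrow> expr \<Rightarrow> bool" where
  "wf_expr \<sigma> (FunX e) \<longleftrightarrow> wf_fun_expr \<sigma> e"
| "wf_expr \<sigma> (PredX p) \<longleftrightarrow> wf_pred_expr \<sigma> p"

primrec fun_expr_sym :: "fun_expr \<Rightarrow> nat" where
  "fun_expr_sym (Assign j f ls) = f"

primrec pred_expr_sym :: "pred_expr \<Rightarrow> nat" where
  "pred_expr_sym (EqTest l l') = 0"
| "pred_expr_sym (RelTest r ls) = r"

primrec expr_sym :: "expr \<Rightarrow> nat" where
  "expr_sym (FunX e) = fun_expr_sym e"
| "expr_sym (PredX p) = pred_expr_sym p"

definition word :: "expr list \<Rightarrow> nat list" where
  "word \<beta> = map expr_sym \<beta>"

primrec assign_terms :: "fun_expr \<Rightarrow> (nat \<Rightarrow> trm) \<Rightarrow> (nat \<Rightarrow> trm)" where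
  "assign_terms (Assign j f ls) M = M(j := Fn f (map M ls))"

primrec next_terms :: "expr \<Rightarrow> (nat \<Rightarrow> trm) \<Rightarrow> (nat \<Rightarrow> trm)" where
  "next_terms (FunX e) M = assign_terms e M"
| "next_terms (PredX p) M = M"

text \<open>Expressions are counted from \<open>0\<close>, so \<open>term_seq n \<beta> i\<close> is \<open>M\<^sub>i\<^sub>+\<^sub>1\<close>, the sequence of terms
  in force when \<open>\<beta> ! i\<close> is reached.\<close>

primrec term_seq :: "nat \<Rightarrow> expr list \<Rightarrow> nat \<Rightarrow> (nat \<Rightarrow> trm)" where
  "term_seq n \<beta> 0 = (\<lambda>i. Var (min i (n - 1)))"
| "term_seq n \<beta> (Suc i) = next_terms (\<beta> ! i) (term_seq n \<beta> i)"

primrec pred_atom :: "(nat \<Rightarrow> trm) \<Rightarrow> pred_expr \<Rightarrow> fm" where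
  "pred_atom M (EqTest l l') = Eq (M l) (M l')"
| "pred_atom M (RelTest r ls) = Rel r (map M ls)"

text \<open>Meaningful only if \<open>\<beta> ! i\<close> is a predicate expression.\<close>

definition kappa :: "nat \<Rightarrow> expr list \<Rightarrow> nat \<Rightarrow> fm" where
  "kappa n \<beta> i = pred_atom (term_seq n \<beta> i) (the_pred (\<beta> ! i))"


section \<open>Computation trees\<close>

text \<open>The two subtrees of a \<open>PredNode\<close> are reached by the edges labeled \<open>0\<close> and \<open>1\<close>,
  in this order.\<close>

datatype ctree =
    Terminal nat
  | FunNode fun_expr ctree
  | PredNode pred_expr ctree ctree

datatype tree_scheme = TreeScheme (tree_dim: nat) (tree_of: ctree)

primrec wf_ctree :: "fo_signature \<Rightarrow> ctree \<Rightarrow> bool" where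
  "wf_ctree \<sigma> (Terminal t) \<longleftrightarrow> True"
| "wf_ctree \<sigma> (FunNode e G) \<longleftrightarrow> wf_fun_expr \<sigma> e \<and> wf_ctree \<sigma> G"
| "wf_ctree \<sigma> (PredNode p G0 G1) \<longleftrightarrow> wf_pred_expr \<sigma> p \<and> wf_ctree \<sigma> G0 \<and> wf_ctree \<sigma> G1"

definition Tree :: "fo_signature \<Rightarrow> tree_scheme set" where
  "Tree \<sigma> = {S. tree_dim S \<ge> 1 \<and> wf_ctree \<sigma> (tree_of S)}"

text \<open>A step of a complete path is a nonterminal node together with the edge leaving it. A
  complete path is the list of its steps together with the label of its terminal node.\<close>

datatype step = FunStep fun_expr | PredStep pred_expr bool

type_synonym path = "step list \<times> nat"

primrec complete_paths :: "ctree \<Rightarrow> path set" where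
  "complete_paths (Terminal t) = {([], t)}"
| "complete_paths (FunNode e G) = (\<lambda>(ds, t). (FunStep e # ds, t)) ` complete_paths G"
| "complete_paths (PredNode p G0 G1) =
     (\<lambda>(ds, t). (PredStep p False # ds, t)) ` complete_paths G0 \<union>
     (\<lambda>(ds, t). (PredStep p True # ds, t)) ` complete_paths G1"

primrec step_expr :: "step \<Rightarrow> expr" where
  "step_expr (FunStep e) = FunX e"
| "step_expr (PredStep p c) = PredX p"

definition path_exprs :: "path \<Rightarrow> expr list" where
  "path_exprs \<tau> = map step_expr (fst \<tau>)"

definition literal :: "fm \<Rightarrow> bool \<Rightarrow> fm" where
  "literal \<alpha> c = (if c then \<alpha> else Neg \<alpha>)"

definition path_literals :: "nat \<Rightarrow> path \<Rightarrow> fm set" where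
  "path_literals n \<tau> =
     {literal (kappa n (path_exprs \<tau>) i) c | i p c. i < length (fst \<tau>) \<and> fst \<tau> ! i = PredStep p c}"

definition tree_value :: "tree_scheme \<Rightarrow> 'a fo_struct \<Rightarrow> 'a list \<Rightarrow> nat" where
  "tree_value S U as =
     snd (THE \<tau>. \<tau> \<in> complete_paths (tree_of S) \<and>
                 (\<forall>\<alpha> \<in> path_literals (tree_dim S) \<tau>. true_on U as \<alpha>))"

definition tree_complexity :: "(nat list \<Rightarrow> nat) \<Rightarrow> tree_scheme \<Rightarrow> nat" where
  "tree_complexity \<psi> S = Max ((\<lambda>\<tau>. \<psi> (word (path_exprs \<tau>))) ` complete_paths (tree_of S))"


section \<open>Problem schemes\<close>

text \<open>Only the values of the function \<open>\<nu>\<close> on lists whose length is the number of predicate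
  expressions are relevant.\<close>

datatype problem_scheme =
  Problem (probl_dim: nat) (probl_fun: "bool list \<Rightarrow> nat") (probl_exprs: "expr list")

definition pred_positions :: "expr list \<Rightarrow> nat list" where
  "pred_positions \<beta> = filter (\<lambda>i. is_PredX (\<beta> ! i)) [0..<length \<beta>]"

definition Probl :: "fo_signature \<Rightarrow> problem_scheme set" where
  "Probl \<sigma> = {s. probl_dim s \<ge> 1 \<and> (\<forall>b \<in> set (probl_exprs s). wf_expr \<sigma> b) \<and>
                 length (pred_positions (probl_exprs s)) \<ge> 1}"

definition probl_value :: "problem_scheme \<Rightarrow> 'a fo_struct \<Rightarrow> 'a list \<Rightarrow> nat" where
  "probl_value s U as =
     probl_fun s (map (\<lambda>i. true_on U as (kappa (probl_dim s) (probl_exprs s) i))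
                      (pred_positions (probl_exprs s)))"

definition solves :: "tree_scheme \<Rightarrow> problem_scheme \<Rightarrow> 'a fo_struct set \<Rightarrow> bool" where
  "solves S s C \<longleftrightarrow> tree_dim S = probl_dim s \<and>
     (C = {} \<or> (\<forall>U \<in> C. \<forall>as \<in> tuples (univ U) (probl_dim s). tree_value S U as = probl_value s U as))"


section \<open>Codes of finite objects\<close>

primrec code_trm :: "trm \<Rightarrow> nat" where
  "code_trm (Var i) = list_encode [0, i]"
| "code_trm (Fn f ts) = list_encode [1, f, list_encode (map code_trm ts)]"

primrec code_fm :: "fm \<Rightarrow> nat" where
  "code_fm (Eq t u) = list_encode [0, code_trm t, code_trm u]"
| "code_fm (Rel r ts) = list_encode [1, r, list_encode (map code_trm ts)]"
| "code_fm (Neg p) = list_encode [2, code_fm p]"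
| "code_fm (And p q) = list_encode [3, code_fm p, code_fm q]"
| "code_fm (Or p q) = list_encode [4, code_fm p, code_fm q]"
| "code_fm (Imp p q) = list_encode [5, code_fm p, code_fm q]"
| "code_fm (All i p) = list_encode [6, i, code_fm p]"
| "code_fm (Ex i p) = list_encode [7, i, code_fm p]"

primrec code_fun_expr :: "fun_expr \<Rightarrow> nat" where
  "code_fun_expr (Assign j f ls) = list_encode [0, j, f, list_encode ls]"

primrec code_pred_expr :: "pred_expr \<Rightarrow> nat" where
  "code_pred_expr (EqTest l l') = list_encode [1, l, l']"
| "code_pred_expr (RelTest r ls) = list_encode [2, r, list_encode ls]"

primrec code_expr :: "expr \<Rightarrow> nat" where
  "code_expr (FunX e) = code_fun_expr e"
| "code_expr (PredX p) = code_pred_expr p"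

primrec code_ctree :: "ctree \<Rightarrow> nat" where
  "code_ctree (Terminal t) = list_encode [0, t]"
| "code_ctree (FunNode e G) = list_encode [1, code_fun_expr e, code_ctree G]"
| "code_ctree (PredNode p G0 G1) =
     list_encode [2, code_pred_expr p, code_ctree G0, code_ctree G1]"

definition code_tree_scheme :: "tree_scheme \<Rightarrow> nat" where
  "code_tree_scheme S = list_encode [tree_dim S, code_ctree (tree_of S)]"

text \<open>The function \<open>\<nu>\<close> is coded by the table of its values on all \<open>k\<close>-tuples of truth values;
  the first component of the tuple varies fastest.\<close>

definition code_problem_scheme :: "problem_scheme \<Rightarrow> nat" where
  "code_problem_scheme s =
     list_encode
       [probl_dim s,
        list_encode (map (probl_fun s)
          (List.n_lists (length (pred_positions (probl_exprs s))) [False, True])),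
        list_encode (map code_expr (probl_exprs s))]"


section \<open>Complexity measures and algorithmic problems\<close>

definition strictly_limited :: "fo_signature \<Rightarrow> (nat list \<Rightarrow> nat) \<Rightarrow> bool" where
  "strictly_limited \<sigma> \<psi> \<longleftrightarrow>
     (\<exists>f. \<forall>w \<in> lists (syms_eq \<sigma>). computes f [list_encode w] (\<psi> w)) \<and>
     (\<forall>w1 \<in> lists (syms_eq \<sigma>). \<forall>w2 \<in> lists (syms_eq \<sigma>). \<forall>w3 \<in> lists (syms_eq \<sigma>).
        w2 \<noteq> [] \<longrightarrow> \<psi> (w1 @ w2 @ w3) > \<psi> (w1 @ w3))"

definition omega_psi :: "fo_signature \<Rightarrow> (nat list \<Rightarrow> nat) \<Rightarrow> nat \<Rightarrow> nat set" where
  "omega_psi \<sigma> \<psi> i = {j \<in> syms_eq \<sigma>. \<psi> [j] = i}"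

definition K_psi :: "fo_signature \<Rightarrow> (nat list \<Rightarrow> nat) \<Rightarrow> nat \<Rightarrow> nat option" where
  "K_psi \<sigma> \<psi> i = (if finite (omega_psi \<sigma> \<psi> i) then Some (card (omega_psi \<sigma> \<psi> i)) else None)"

definition total_recursive :: "(nat \<Rightarrow> nat option) \<Rightarrow> bool" where
  "total_recursive g \<longleftrightarrow> (\<exists>f. \<forall>i. \<exists>y. g i = Some y \<and> computes f [i] y)"

text \<open>The inputs of both problems below are codes of \<open>\<alpha> \<in> H\<close> and of schemes over \<open>\<sigma>\<close>; nothing
  is required of the algorithm on other inputs, so \<open>H\<close> itself need not be decidable.\<close>

definition solvability_decidable :: "fo_signature \<Rightarrow> fm set \<Rightarrow> 'a fo_struct set \<Rightarrow> bool" where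
  "solvability_decidable \<sigma> H C \<longleftrightarrow>
     (\<exists>f. \<forall>\<alpha> \<in> H. \<forall>s \<in> Probl \<sigma>. \<forall>S \<in> Tree \<sigma>.
        computes f [code_fm \<alpha>, code_problem_scheme s, code_tree_scheme S]
          (if solves S s (restrict_class C \<alpha>) then 1 else 0))"

definition e_optimal ::
  "fo_signature \<Rightarrow> (nat list \<Rightarrow> nat) \<Rightarrow> 'a fo_struct set \<Rightarrow> problem_scheme \<Rightarrow> tree_scheme \<Rightarrow> bool" where
  "e_optimal \<sigma> \<psi> C s S \<longleftrightarrow> S \<in> Tree \<sigma> \<and> solves S s C \<and>
     (\<forall>S' \<in> Tree \<sigma>. solves S' s C \<longrightarrow> tree_complexity \<psi> S \<le> tree_complexity \<psi> S')"

definition e_optimization_decidable ::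
  "fo_signature \<Rightarrow> (nat list \<Rightarrow> nat) \<Rightarrow> fm set \<Rightarrow> 'a fo_struct set \<Rightarrow> bool" where
  "e_optimization_decidable \<sigma> \<psi> H C \<longleftrightarrow>
     (\<exists>f. \<forall>\<alpha> \<in> H. \<forall>s \<in> Probl \<sigma>. \<exists>S.
        computes f [code_fm \<alpha>, code_problem_scheme s] (code_tree_scheme S) \<and>
        e_optimal \<sigma> \<psi> (restrict_class C \<alpha>) s S)"

end

theory Submission
  imports Defs
begin

text \<open>
  Strict monotonicity of \<open>\<psi>\<close> bounds the depth of a tree of complexity at most \<open>B\<close> by \<open>B\<close>, and
  bounds the complexity of each symbol in it by \<open>B\<close>. Since \<open>K\<^sub>\<psi>\<close> is total recursive, one can tell when
  all symbols of complexity at most \<open>B\<close> have been found, so finitely many symbols, computable from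
  \<open>B\<close>, can occur. The variables of a tree may be renamed injectively, fixing \<open>x\<^sub>0, \<dots>, x\<^sub>n\<^sub>-\<^sub>1\<close>, and
  its labels truncated at any bound for the values of \<open>\<nu>\<close>, without changing its complexity or the fact
  that it solves \<open>s\<close>. Hence if some tree of complexity at most \<open>B\<close> solves \<open>s\<close>, then so does one whose
  code is below a computable bound \<open>N B s\<close>. The algorithm searches for the least \<open>B\<close> for which some
  code below \<open>N B s\<close> belongs to a tree of complexity at most \<open>B\<close> solving \<open>s\<close>; the search ends
  because evaluating all expressions of \<open>s\<close> in turn is a tree that solves \<open>s\<close>.
\<close>

section \<open>Functions recursive on a set of argument tuples\<close>

text \<open>The predicate \<open>P\<close> restricts the arguments, because an oracle such as the one for solvability
  is only guaranteed to halt on codes of admissible inputs.\<close>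

definition rec_on :: "nat \<Rightarrow> (nat list \<Rightarrow> bool) \<Rightarrow> (nat list \<Rightarrow> nat) \<Rightarrow> bool" where
  "rec_on k P F \<longleftrightarrow> (\<exists>f. \<forall>xs. length xs = k \<longrightarrow> P xs \<longrightarrow> computes f xs (F xs))"

definition dec_on :: "nat \<Rightarrow> (nat list \<Rightarrow> bool) \<Rightarrow> (nat list \<Rightarrow> bool) \<Rightarrow> bool" where
  "dec_on k P Q \<longleftrightarrow> rec_on k P (\<lambda>xs. of_bool (Q xs))"

abbreviation rec1 :: "(nat \<Rightarrow> nat) \<Rightarrow> bool" where
  "rec1 g \<equiv> rec_on 1 (\<lambda>_. True) (\<lambda>xs. g (xs ! 0))"

abbreviation rec2 :: "(nat \<Rightarrow> nat \<Rightarrow> nat) \<Rightarrow> bool" where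
  "rec2 g \<equiv> rec_on 2 (\<lambda>_. True) (\<lambda>xs. g (xs ! 0) (xs ! 1))"

abbreviation rec3 :: "(nat \<Rightarrow> nat \<Rightarrow> nat \<Rightarrow> nat) \<Rightarrow> bool" where
  "rec3 g \<equiv> rec_on 3 (\<lambda>_. True) (\<lambda>xs. g (xs ! 0) (xs ! 1) (xs ! 2))"

named_theorems rec_intros

lemma rec_onI: "(\<And>xs. length xs = k \<Longrightarrow> P xs \<Longrightarrow> computes f xs (F xs)) \<Longrightarrow> rec_on k P F"
  by (auto simp: rec_on_def)

lemma rec_on_cong:
  assumes "rec_on k P F" "\<And>xs. length xs = k \<Longrightarrow> P xs \<Longrightarrow> F xs = G xs"
  shows "rec_on k P G"
  using assms by (metis rec_on_def)

text \<open>The last premise is the obligation that the inner values meet the precondition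
  \<open>Q\<close> of \<open>G\<close>. For total \<open>G\<close> it is vacuous, which gives
  \<open>rec_on_comp1\<close> to \<open>rec_on_comp3\<close>.\<close>

lemma rec_on_comp:
  assumes "rec_on m Q G" "length Fs = m" "\<And>F. F \<in> set Fs \<Longrightarrow> rec_on k P F"
    and "\<And>xs. length xs = k \<Longrightarrow> P xs \<Longrightarrow> Q (map (\<lambda>F. F xs) Fs)"
  shows "rec_on k P (\<lambda>xs. G (map (\<lambda>F. F xs) Fs))"
proof -
  obtain g where g: "\<And>xs. length xs = m \<Longrightarrow> Q xs \<Longrightarrow> computes g xs (G xs)"
    using assms(1) by (auto simp: rec_on_def)
  obtain h where h: "\<And>F xs. F \<in> set Fs \<Longrightarrow> length xs = k \<Longrightarrow> P xs \<Longrightarrow> computes (h F) xs (F xs)"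
    using assms(3) unfolding rec_on_def by metis
  show ?thesis
  proof (rule rec_onI)
    fix xs assume xs: "length xs = k" "P xs"
    show "computes (Comp g (map h Fs)) xs (G (map (\<lambda>F. F xs) Fs))"
    proof (rule computes_Comp)
      show "list_all2 (\<lambda>g y. computes g xs y) (map h Fs) (map (\<lambda>F. F xs) Fs)"
        using h xs by (auto simp: list_all2_map1 list_all2_map2 intro: list.rel_refl_strong)
    qed (use g xs assms in auto)
  qed
qed

lemma rec_on_comp1: "rec1 g \<Longrightarrow> rec_on k P F \<Longrightarrow> rec_on k P (\<lambda>xs. g (F xs))"
  using rec_on_comp[of 1 "\<lambda>_. True" "\<lambda>xs. g (xs ! 0)" "[F]" k P] by simp

lemma rec_on_comp2: "rec2 g \<Longrightarrow> rec_on k P F \<Longrightarrow> rec_on k P G \<Longrightarrow> rec_on k P (\<lambda>xs. g (F xs) (G xs))"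
  using rec_on_comp[of 2 "\<lambda>_. True" "\<lambda>xs. g (xs ! 0) (xs ! 1)" "[F, G]" k P] by auto

lemma rec_on_comp3: "rec3 g \<Longrightarrow> rec_on k P F \<Longrightarrow> rec_on k P G \<Longrightarrow> rec_on k P H \<Longrightarrow>
    rec_on k P (\<lambda>xs. g (F xs) (G xs) (H xs))"
  using rec_on_comp[of 3 "\<lambda>_. True" "\<lambda>xs. g (xs ! 0) (xs ! 1) (xs ! 2)" "[F, G, H]" k P] by auto

lemma rec_on_nth [rec_intros]: "i < k \<Longrightarrow> rec_on k P (\<lambda>xs. xs ! i)"
  by (rule rec_onI[of _ _ "Proj i"]) (auto intro: computes_Proj)

text \<open>The rules for recursion, sums, bounded quantifiers and search put new variables in front
  of the tuple, so their premises refer to the old arguments through \<open>tl\<close>.\<close>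

lemma rec_on_tl_nth [rec_intros]: "Suc i < k \<Longrightarrow> rec_on k P (\<lambda>xs. tl xs ! i)"
  by (rule rec_on_cong[OF rec_on_nth[of "Suc i"]]) (auto simp: nth_tl)

lemma rec_on_tl_tl_nth [rec_intros]: "Suc (Suc i) < k \<Longrightarrow> rec_on k P (\<lambda>xs. tl (tl xs) ! i)"
  by (rule rec_on_cong[OF rec_on_nth[of "Suc (Suc i)"]]) (auto simp: nth_tl)

lemma rec_on_hd [rec_intros]: "0 < k \<Longrightarrow> rec_on k P hd"
  by (rule rec_on_cong[OF rec_on_nth[of 0]]) (auto simp: hd_conv_nth)

lemma rec_on_hd_tl [rec_intros]: "Suc 0 < k \<Longrightarrow> rec_on k P (\<lambda>xs. hd (tl xs))"
  by (rule rec_on_cong[OF rec_on_tl_nth[of 0]]) (auto simp: hd_conv_nth simp flip: length_greater_0_conv)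

lemma rec_on_Suc [rec_intros]: "rec_on k P F \<Longrightarrow> rec_on k P (\<lambda>xs. Suc (F xs))"
proof (rule rec_on_comp1[of Suc])
  show "rec1 Suc"
    by (rule rec_onI[of _ _ Succ]) (auto simp: length_Suc_conv intro: computes_Succ)
qed

lemma rec_on_const [rec_intros]: "rec_on k P (\<lambda>xs. c)"
proof (induction c)
  case 0
  show ?case by (rule rec_onI[of _ _ Zero]) (rule computes_Zero)
qed (rule rec_on_Suc)

lemma rec_on_rec_nat:
  assumes "rec_on k P a"
    and "rec_on (Suc (Suc k)) (\<lambda>ys. P (tl (tl ys))) (\<lambda>ys. b (hd ys) (hd (tl ys)) (tl (tl ys)))"
    and "rec_on k P m"
  shows "rec_on k P (\<lambda>xs. rec_nat (a xs) (\<lambda>n r. b n r xs) (m xs))"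
proof -
  obtain fa where fa: "\<And>xs. length xs = k \<Longrightarrow> P xs \<Longrightarrow> computes fa xs (a xs)"
    using assms(1) by (auto simp: rec_on_def)
  obtain fb where fb: "\<And>ys. length ys = Suc (Suc k) \<Longrightarrow> P (tl (tl ys)) \<Longrightarrow>
      computes fb ys (b (hd ys) (hd (tl ys)) (tl (tl ys)))"
    using assms(2) by (auto simp: rec_on_def)
  have pr: "computes (PrimRec fa fb) (n # xs) (rec_nat (a xs) (\<lambda>n r. b n r xs) n)"
    if "length xs = k" "P xs" for n xs
  proof (induction n)
    case 0
    then show ?case using fa that by (auto intro: computes_PrimRec_0)
  next
    case (Suc n)
    then show ?case using fb[of "n # _ # xs"] that by (auto intro: computes_PrimRec_Suc)
  qed
  have "rec_on (Suc k) (\<lambda>ys. P (tl ys)) (\<lambda>ys. rec_nat (a (tl ys)) (\<lambda>n r. b n r (tl ys)) (hd ys))"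
    by (rule rec_onI[of _ _ "PrimRec fa fb"]) (auto simp: length_Suc_conv intro: pr)
  \<comment> \<open>The recursor expects the counter followed by the parameters: \<open>m\<close>
    supplies the counter, and the \<open>k\<close> projections copy the tuple.\<close>
  from rec_on_comp[OF this, of "m # map (\<lambda>i xs. xs ! i) [0..<k]" k P]
  have "rec_on k P (\<lambda>xs. rec_nat (a (map (\<lambda>i. xs ! i) [0..<k]))
      (\<lambda>n r. b n r (map (\<lambda>i. xs ! i) [0..<k])) (m xs))"
    using assms(3) by (force simp: comp_def map_nth intro: rec_on_nth)
  then show ?thesis by (rule rec_on_cong) (metis map_nth)
qed

section \<open>Arithmetic functions and decidable predicates\<close>

lemma rec_on_add [rec_intros]: "rec_on k P F \<Longrightarrow> rec_on k P G \<Longrightarrow> rec_on k P (\<lambda>xs. F xs + G xs)"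
proof (rule rec_on_comp2[of "(+)"])
  have "rec2 (\<lambda>x y. rec_nat x (\<lambda>_ r. Suc r) y)"
    by (intro rec_on_rec_nat rec_intros; simp)
  moreover have "rec_nat x (\<lambda>_ r. Suc r) y = x + y" for x y by (induction y) auto
  ultimately show "rec2 (+)" by simp
qed

lemma rec_on_mult [rec_intros]: "rec_on k P F \<Longrightarrow> rec_on k P G \<Longrightarrow> rec_on k P (\<lambda>xs. F xs * G xs)"
proof (rule rec_on_comp2[of "(*)"])
  have "rec2 (\<lambda>x y. rec_nat 0 (\<lambda>_ r. r + x) y)"
    by (intro rec_on_rec_nat rec_intros; simp)
  moreover have "rec_nat 0 (\<lambda>_ r. r + x) y = x * y" for x y :: nat by (induction y) auto
  ultimately show "rec2 (*)" by simp
qed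

lemma rec_on_power [rec_intros]: "rec_on k P F \<Longrightarrow> rec_on k P G \<Longrightarrow> rec_on k P (\<lambda>xs. F xs ^ G xs)"
proof (rule rec_on_comp2[of "(^)"])
  have "rec2 (\<lambda>x y. rec_nat 1 (\<lambda>_ r. r * x) y)"
    by (intro rec_on_rec_nat rec_intros; simp)
  moreover have "rec_nat 1 (\<lambda>_ r. r * x) y = x ^ y" for x y :: nat by (induction y) auto
  ultimately show "rec2 (^)" by simp
qed

lemma rec_on_diff [rec_intros]: "rec_on k P F \<Longrightarrow> rec_on k P G \<Longrightarrow> rec_on k P (\<lambda>xs. F xs - G xs)"
proof (rule rec_on_comp2[of "(-)"])
  \<comment> \<open>The predecessor comes first; subtraction iterates it.\<close>
  have "rec1 (rec_nat 0 (\<lambda>n _. n))"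
    by (intro rec_on_rec_nat rec_intros; simp)
  moreover have "rec_nat 0 (\<lambda>n _. n) y = y - 1" for y by (induction y) auto
  ultimately have 1: "rec1 (\<lambda>y. y - 1)" by simp
  have "rec2 (\<lambda>x y. rec_nat x (\<lambda>_ r. r - 1) y)"
    by (intro rec_on_rec_nat rec_intros rec_on_comp1[OF 1]; simp)
  moreover have "rec_nat x (\<lambda>_ r. r - 1) y = x - y" for x y :: nat by (induction y) auto
  ultimately show "rec2 (-)" by simp
qed

text \<open>Truncated subtraction serves as the test: \<open>F xs - G xs\<close> vanishes exactly if
  \<open>F xs \<le> G xs\<close>.\<close>

lemma dec_on_le [rec_intros]: "rec_on k P F \<Longrightarrow> rec_on k P G \<Longrightarrow> dec_on k P (\<lambda>xs. F xs \<le> G xs)"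
  unfolding dec_on_def
  by (rule rec_on_cong[of _ _ "\<lambda>xs. 1 - (F xs - G xs)"]) (auto intro!: rec_intros)

lemma dec_on_not [rec_intros]: "dec_on k P Q \<Longrightarrow> dec_on k P (\<lambda>xs. \<not> Q xs)"
  unfolding dec_on_def
  by (rule rec_on_cong[of _ _ "\<lambda>xs. 1 - of_bool (Q xs)"]) (auto intro!: rec_intros)

lemma dec_on_conj [rec_intros]: "dec_on k P Q \<Longrightarrow> dec_on k P R \<Longrightarrow> dec_on k P (\<lambda>xs. Q xs \<and> R xs)"
  unfolding dec_on_def
  by (rule rec_on_cong[of _ _ "\<lambda>xs. of_bool (Q xs) * of_bool (R xs)"]) (auto intro!: rec_intros)

lemma dec_on_disj [rec_intros]: "dec_on k P Q \<Longrightarrow> dec_on k P R \<Longrightarrow> dec_on k P (\<lambda>xs. Q xs \<or> R xs)"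
  using dec_on_not[OF dec_on_conj[OF dec_on_not dec_on_not]] by simp

lemma dec_on_eq [rec_intros]: "rec_on k P F \<Longrightarrow> rec_on k P G \<Longrightarrow> dec_on k P (\<lambda>xs. F xs = G xs)"
  using dec_on_conj[OF dec_on_le dec_on_le, of k P F G G F] by (simp add: eq_iff)

lemma dec_on_less [rec_intros]: "rec_on k P F \<Longrightarrow> rec_on k P G \<Longrightarrow> dec_on k P (\<lambda>xs. F xs < G xs)"
  using dec_on_not[OF dec_on_le, of k P G F] by (simp add: not_le)

lemma rec_on_of_bool [rec_intros]: "dec_on k P Q \<Longrightarrow> rec_on k P (\<lambda>xs. of_bool (Q xs))"
  by (simp add: dec_on_def)

text \<open>The branches are combined arithmetically, so both get evaluated. Each must be computable
  on all of \<open>P\<close>, even where the other one is selected.\<close>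

lemma rec_on_if [rec_intros]:
  "dec_on k P Q \<Longrightarrow> rec_on k P F \<Longrightarrow> rec_on k P G \<Longrightarrow> rec_on k P (\<lambda>xs. if Q xs then F xs else G xs)"
  unfolding dec_on_def
  by (rule rec_on_cong[of _ _ "\<lambda>xs. of_bool (Q xs) * F xs + (1 - of_bool (Q xs)) * G xs"])
    (auto intro!: rec_intros)

section \<open>Bounded sums, bounded quantifiers and unbounded search\<close>

lemma rec_on_sum [rec_intros]:
  assumes "rec_on (Suc k) (\<lambda>ys. P (tl ys)) (\<lambda>ys. F (hd ys) (tl ys))" "rec_on k P m"
  shows "rec_on k P (\<lambda>xs. \<Sum>i<m xs. F i xs)"
proof -
  \<comment> \<open>The step function of a primitive recursion also receives the previous value, so
    \<open>F\<close> is re-indexed to skip this second argument.\<close>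
  have "rec_on (Suc (Suc k)) (\<lambda>ys. P (tl (tl ys))) (\<lambda>ys. F (hd ys) (tl (tl ys)))"
  proof -
    let ?Fs = "hd # map (\<lambda>i xs. tl (tl xs) ! i) [0..<k]"
    have *: "map (\<lambda>G. G ys) ?Fs = hd ys # tl (tl ys)" if "length ys = Suc (Suc k)" for ys :: "nat list"
      using that by (auto simp: comp_def length_Suc_conv map_nth)
    have "rec_on (Suc (Suc k)) (\<lambda>ys. P (tl (tl ys)))
        (\<lambda>ys. (\<lambda>ys. F (hd ys) (tl ys)) (map (\<lambda>G. G ys) ?Fs))"
      by (rule rec_on_comp[OF assms(1)]) (use * in \<open>auto intro!: rec_intros\<close>)
    then show ?thesis by (rule rec_on_cong) (subst *, auto)
  qed
  then have "rec_on k P (\<lambda>xs. rec_nat 0 (\<lambda>n r. r + F n xs) (m xs))"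
    by (intro rec_on_rec_nat rec_intros assms(2)) auto
  moreover have "rec_nat 0 (\<lambda>n r. r + F n xs) j = (\<Sum>i<j. F i xs)" for j xs
    by (induction j) auto
  ultimately show ?thesis by simp
qed

lemma dec_on_ex_less [rec_intros]:
  assumes "dec_on (Suc k) (\<lambda>ys. P (tl ys)) (\<lambda>ys. Q (hd ys) (tl ys))" "rec_on k P m"
  shows "dec_on k P (\<lambda>xs. \<exists>i<m xs. Q i xs)"
proof -
  have "dec_on k P (\<lambda>xs. 0 < (\<Sum>i<m xs. of_bool (Q i xs) :: nat))"
    using assms by (intro rec_intros)
  moreover have "0 < (\<Sum>i<j. of_bool (Q i xs) :: nat) \<longleftrightarrow> (\<exists>i<j. Q i xs)" for j xs
    by (auto simp del: sum_of_bool_eq simp: zero_less_iff_neq_zero)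
  ultimately show ?thesis by simp
qed

lemma dec_on_all_less [rec_intros]:
  assumes "dec_on (Suc k) (\<lambda>ys. P (tl ys)) (\<lambda>ys. Q (hd ys) (tl ys))" "rec_on k P m"
  shows "dec_on k P (\<lambda>xs. \<forall>i<m xs. Q i xs)"
  using dec_on_not[OF dec_on_ex_less[OF dec_on_not[OF assms(1)] assms(2)]] by simp

text \<open>The search ends because a witness exists and the test halts on every candidate.
  \<open>Mu\<close> looks for a zero, hence the indicator of the negation.\<close>

lemma rec_on_Least:
  assumes "dec_on (Suc k) (\<lambda>ys. P (tl ys)) (\<lambda>ys. Q (hd ys) (tl ys))"
    and "\<And>xs. length xs = k \<Longrightarrow> P xs \<Longrightarrow> \<exists>n. Q n xs"
  shows "rec_on k P (\<lambda>xs. LEAST n. Q n xs)"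
proof -
  obtain f where f: "\<And>n xs. length xs = k \<Longrightarrow> P xs \<Longrightarrow> computes f (n # xs) (of_bool (\<not> Q n xs))"
    using dec_on_not[OF assms(1)] unfolding dec_on_def rec_on_def
    by (metis length_Cons list.sel(1,3))
  show ?thesis
  proof (rule rec_onI)
    fix xs assume xs: "length xs = k" "P xs"
    let ?n = "LEAST n. Q n xs"
    have n: "Q ?n xs" using assms(2)[OF xs] by (rule LeastI_ex)
    show "computes (Mu f) xs ?n"
    proof (rule computes_Mu)
      show "computes f (?n # xs) 0" using f[OF xs, of ?n] n by simp
      show "\<forall>m<?n. \<exists>y. computes f (m # xs) (Suc y)"
        using f[OF xs] not_less_Least[of _ "\<lambda>n. Q n xs"] by (metis One_nat_def of_bool_eq(2))
    qed
  qed
qed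

section \<open>Coded lists\<close>

lemma rec_on_prod_encode [rec_intros]:
  assumes "rec_on k P F" "rec_on k P G"
  shows "rec_on k P (\<lambda>xs. prod_encode (F xs, G xs))"
proof -
  have "rec1 (rec_nat 0 (\<lambda>n r. r + Suc n))"
    by (intro rec_on_rec_nat rec_intros; simp)
  moreover have "rec_nat 0 (\<lambda>n r. r + Suc n) n = triangle n" for n by (induction n) auto
  ultimately have "rec1 triangle" by simp
  from rec_on_comp1[OF this] show ?thesis
    using assms by (simp add: prod_encode_def rec_on_add)
qed

text \<open>Decoding is a search: \<open>prod_encode\<close> dominates both arguments, so the
  partner of the component sought is bounded by the code.\<close>

lemma rec_on_fst_prod_decode [rec_intros]:
  assumes "rec_on k P F"
  shows "rec_on k P (\<lambda>xs. fst (prod_decode (F xs)))"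
proof (rule rec_on_comp1[of "\<lambda>z. fst (prod_decode z)"])
  have eq: "(LEAST a. \<exists>b<Suc z. prod_encode (a, b) = z) = fst (prod_decode z)" for z
  proof (rule Least_equality)
    have "snd (prod_decode z) < Suc z"
      by (metis le_prod_encode_2 less_Suc_eq_le prod.collapse prod_decode_inverse)
    then show "\<exists>b<Suc z. prod_encode (fst (prod_decode z), b) = z"
      by (intro exI[of _ "snd (prod_decode z)"]) simp
  qed auto
  have "rec1 (\<lambda>z. LEAST a. \<exists>b<Suc z. prod_encode (a, b) = z)"
  proof (rule rec_on_Least)
    show "\<exists>a. \<exists>b<Suc (xs ! 0). prod_encode (a, b) = xs ! 0" for xs :: "nat list"
      by (metis le_prod_encode_2 less_Suc_eq_le prod.collapse prod_decode_inverse)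
  qed (intro rec_intros; simp)
  then show "rec1 (\<lambda>z. fst (prod_decode z))" by (simp add: eq)
qed (fact assms)

lemma rec_on_snd_prod_decode [rec_intros]:
  assumes "rec_on k P F"
  shows "rec_on k P (\<lambda>xs. snd (prod_decode (F xs)))"
proof (rule rec_on_comp1[of "\<lambda>z. snd (prod_decode z)"])
  have eq: "(LEAST b. \<exists>a<Suc z. prod_encode (a, b) = z) = snd (prod_decode z)" for z
  proof (rule Least_equality)
    have "fst (prod_decode z) < Suc z"
      by (metis le_prod_encode_1 less_Suc_eq_le prod.collapse prod_decode_inverse)
    then show "\<exists>a<Suc z. prod_encode (a, snd (prod_decode z)) = z"
      by (intro exI[of _ "fst (prod_decode z)"]) simp
  qed auto
  have "rec1 (\<lambda>z. LEAST b. \<exists>a<Suc z. prod_encode (a, b) = z)"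
  proof (rule rec_on_Least)
    show "\<exists>b. \<exists>a<Suc (xs ! 0). prod_encode (a, b) = xs ! 0" for xs :: "nat list"
      by (metis le_prod_encode_1 less_Suc_eq_le prod.collapse prod_decode_inverse)
  qed (intro rec_intros; simp)
  then show "rec1 (\<lambda>z. snd (prod_decode z))" by (simp add: eq)
qed (fact assms)

definition ccons :: "nat \<Rightarrow> nat \<Rightarrow> nat" where
  "ccons x l = Suc (prod_encode (x, l))"

text \<open>\<open>list_encode []\<close> is \<open>0\<close>, and \<open>chd 0 = ctl 0 = 0\<close>.\<close>

definition chd :: "nat \<Rightarrow> nat" where
  "chd l = fst (prod_decode (l - 1))"

definition ctl :: "nat \<Rightarrow> nat" where
  "ctl l = snd (prod_decode (l - 1))"

definition cdrop :: "nat \<Rightarrow> nat \<Rightarrow> nat" where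
  "cdrop i l = rec_nat l (\<lambda>_. ctl) i"

definition cnth :: "nat \<Rightarrow> nat \<Rightarrow> nat" where
  "cnth l i = chd (cdrop i l)"

text \<open>Every number codes a list and only the empty list has code \<open>0\<close>, so the
  length is found by dropping elements until \<open>0\<close> appears.\<close>

definition clen :: "nat \<Rightarrow> nat" where
  "clen l = (LEAST i. cdrop i l = 0)"

lemma list_encode_Cons: "list_encode (x # xs) = ccons x (list_encode xs)"
  by (simp add: ccons_def)

lemma chd_ccons [simp]: "chd (ccons x l) = x"
  by (simp add: ccons_def chd_def)

lemma ctl_ccons [simp]: "ctl (ccons x l) = l"
  by (simp add: ccons_def ctl_def)

lemma ccons_neq_0 [simp]: "ccons x l \<noteq> 0" "0 \<noteq> ccons x l"
  by (simp_all add: ccons_def)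

lemma ctl_0: "ctl 0 = 0"
proof -
  have "prod_decode 0 = (0, 0)"
    by (simp add: prod_decode_def prod_decode_aux.simps)
  then show ?thesis by (simp add: ctl_def)
qed

lemma cdrop_list_encode: "cdrop i (list_encode xs) = list_encode (drop i xs)"
proof (induction i)
  case (Suc i)
  show ?case
  proof (cases "drop i xs")
    case Nil
    with Suc show ?thesis by (simp add: cdrop_def ctl_0)
  next
    case (Cons y ys)
    then have "drop (Suc i) xs = ys" by (metis drop_Suc list.sel(3) tl_drop)
    with Cons Suc show ?thesis by (simp add: cdrop_def list_encode_Cons del: list_encode.simps(2))
  qed
qed (simp add: cdrop_def)

lemma cnth_list_encode: "i < length xs \<Longrightarrow> cnth (list_encode xs) i = xs ! i"
  by (simp add: cnth_def cdrop_list_encode list_encode_Cons del: list_encode.simps(2)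
      flip: Cons_nth_drop_Suc)

lemma list_encode_eq_0_iff: "list_encode xs = 0 \<longleftrightarrow> xs = []"
  by (cases xs) auto

lemma clen_list_encode: "clen (list_encode xs) = length xs"
  unfolding clen_def cdrop_list_encode list_encode_eq_0_iff
  by (rule Least_equality) auto

lemma rec_on_ccons [rec_intros]: "rec_on k P F \<Longrightarrow> rec_on k P G \<Longrightarrow> rec_on k P (\<lambda>xs. ccons (F xs) (G xs))"
  unfolding ccons_def by (intro rec_intros)

lemma rec_on_chd [rec_intros]: "rec_on k P F \<Longrightarrow> rec_on k P (\<lambda>xs. chd (F xs))"
  unfolding chd_def by (intro rec_intros)

lemma rec_on_ctl [rec_intros]: "rec_on k P F \<Longrightarrow> rec_on k P (\<lambda>xs. ctl (F xs))"
  unfolding ctl_def by (intro rec_intros)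

lemma rec_on_cdrop [rec_intros]: "rec_on k P F \<Longrightarrow> rec_on k P G \<Longrightarrow> rec_on k P (\<lambda>xs. cdrop (F xs) (G xs))"
proof (rule rec_on_comp2[of cdrop])
  show "rec2 cdrop"
    unfolding cdrop_def by (intro rec_on_rec_nat rec_intros; simp)
qed

lemma rec_on_cnth [rec_intros]: "rec_on k P F \<Longrightarrow> rec_on k P G \<Longrightarrow> rec_on k P (\<lambda>xs. cnth (F xs) (G xs))"
  unfolding cnth_def by (intro rec_intros)

lemma rec_on_clen [rec_intros]: "rec_on k P F \<Longrightarrow> rec_on k P (\<lambda>xs. clen (F xs))"
proof (rule rec_on_comp1[of clen])
  show "rec1 clen"
    unfolding clen_def
  proof (rule rec_on_Least)
    show "\<exists>i. cdrop i (xs ! 0) = 0" for xs :: "nat list"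
      by (metis cdrop_list_encode drop_all le_refl list_decode_inverse list_encode.simps(1))
  qed (intro rec_intros; simp)
qed

lemma mem_less_list_encode: "x \<in> set xs \<Longrightarrow> x < list_encode xs"
proof (induction xs)
  case (Cons a xs)
  then show ?case
    using le_prod_encode_1[of a "list_encode xs"] le_prod_encode_2[of "list_encode xs" a] by fastforce
qed simp

lemma cnth_less: "i < clen c \<Longrightarrow> cnth c i < c"
  using mem_less_list_encode[of _ "list_decode c"] cnth_list_encode[of i "list_decode c"]
    clen_list_encode[of "list_decode c"]
  by simp

lemma clen_0 [simp]: "clen 0 = 0"
  using clen_list_encode[of "[]"] by simp

lemma clen_ccons [simp]: "clen (ccons x l) = Suc (clen l)"
  using clen_list_encode[of "x # list_decode l"] clen_list_encode[of "list_decode l"]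
  by (simp add: ccons_def)

lemma cnth_ccons_0 [simp]: "cnth (ccons x l) 0 = x"
  by (simp add: cnth_def cdrop_def)

lemma cnth_ccons_Suc [simp]: "cnth (ccons x l) (Suc i) = cnth l i"
proof -
  have "cdrop (Suc i) (ccons x (list_encode xs)) = cdrop i (list_encode xs)" for xs
    using cdrop_list_encode[of "Suc i" "x # xs"] cdrop_list_encode[of i xs]
    by (simp add: list_encode_Cons del: list_encode.simps(2))
  from this[of "list_decode l"] show ?thesis by (simp add: cnth_def)
qed

lemma cnth_ccons_numeral [simp]: "cnth (ccons x l) (numeral k) = cnth l (pred_numeral k)"
  by (simp add: numeral_eq_Suc)

lemma clen_eq_0_iff: "clen c = 0 \<longleftrightarrow> c = 0"
  by (metis clen_list_encode length_0_conv list_decode_inverse list_encode_eq_0_iff)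

text \<open>Together with \<open>clen_eq_0_iff\<close> this writes a number of known length as
  nested \<open>ccons\<close>, the shape in which codes of syntax are recognized.\<close>

lemma clen_eq_Suc_iff: "clen c = Suc n \<longleftrightarrow> (\<exists>x l. c = ccons x l \<and> clen l = n)"
proof
  assume *: "clen c = Suc n"
  then obtain x xs where "list_decode c = x # xs"
    by (metis clen_list_encode length_Suc_conv list_decode_inverse)
  then have "c = ccons x (list_encode xs)"
    by (metis list_decode_inverse list_encode_Cons)
  with * show "\<exists>x l. c = ccons x l \<and> clen l = n" by auto
qed auto

text \<open>Puts \<open>f\<close> in front of every word in the coded list \<open>l\<close> of coded words, and moves the words onto \<open>m\<close>.
  The code \<open>l\<close> itself is used as a bound on the number of iterations.\<close>

definition cpush :: "nat \<Rightarrow> nat \<Rightarrow> nat \<Rightarrow> nat" where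
  "cpush f l m = snd (prod_decode (rec_nat (prod_encode (l, m))
     (\<lambda>_ z. if fst (prod_decode z) = 0 then z else
        prod_encode (ctl (fst (prod_decode z)),
          ccons (ccons f (chd (fst (prod_decode z)))) (snd (prod_decode z)))) l))"

lemma length_le_list_encode: "length xs \<le> list_encode xs"
proof (induction xs)
  case (Cons a xs)
  then show ?case using le_prod_encode_2[of "list_encode xs" a] by simp
qed simp

lemma cpush_list_encode:
  "cpush f (list_encode xs) (list_encode ys) = list_encode (rev (map (ccons f) xs) @ ys)"
proof -
  define it where "it = rec_nat (prod_encode (list_encode xs, list_encode ys))
     (\<lambda>_ z. if fst (prod_decode z) = 0 then z else
        prod_encode (ctl (fst (prod_decode z)),
          ccons (ccons f (chd (fst (prod_decode z)))) (snd (prod_decode z))))"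
  \<comment> \<open>Invariant: after \<open>n\<close> rounds the first \<open>n\<close> words have
    been moved. Nothing changes once the source is empty, so surplus rounds are harmless.\<close>
  have it: "it n = prod_encode (list_encode (drop n xs), list_encode (rev (map (ccons f) (take n xs)) @ ys))"
    for n
  proof (induction n)
    case (Suc n)
    show ?case
    proof (cases "n < length xs")
      case True
      then have "drop n xs = xs ! n # drop (Suc n) xs" "take (Suc n) xs = take n xs @ [xs ! n]"
        by (simp_all add: Cons_nth_drop_Suc take_Suc_conv_app_nth)
      with Suc show ?thesis by (simp add: it_def list_encode_Cons del: list_encode.simps(2))
    qed (use Suc in \<open>simp add: it_def\<close>)
  qed (simp add: it_def)
  show ?thesis
    using it[of "list_encode xs"] length_le_list_encode[of xs]
    by (simp add: cpush_def it_def)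
qed

lemma rec_on_cpush [rec_intros]:
  "rec_on k P F \<Longrightarrow> rec_on k P G \<Longrightarrow> rec_on k P H \<Longrightarrow> rec_on k P (\<lambda>xs. cpush (F xs) (G xs) (H xs))"
proof (rule rec_on_comp3[of cpush])
  show "rec3 cpush"
    unfolding cpush_def by (intro rec_on_rec_nat rec_intros; simp)
qed

section \<open>Codes of computation trees\<close>

lemma rec_on_comp1_on:
  assumes "rec_on 1 (\<lambda>xs. Q (xs ! 0)) (\<lambda>xs. g (xs ! 0))" "rec_on k P F"
    and "\<And>xs. length xs = k \<Longrightarrow> P xs \<Longrightarrow> Q (F xs)"
  shows "rec_on k P (\<lambda>xs. g (F xs))"
  using rec_on_comp[OF assms(1), of "[F]" k P] assms(2,3) by simp

text \<open>Holds for arbitrary \<open>g\<close>, since finitely many values can be built into the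
  program as constants.\<close>

lemma rec1_finite_support: "rec1 (\<lambda>j. if j \<in> {1..m} then g j else 0)"
proof (induction m)
  case (Suc m)
  have "rec1 (\<lambda>j. if j = Suc m then g (Suc m) else if j \<in> {1..m} then g j else 0)"
    by (intro rec_on_if Suc.IH rec_intros) simp
  then show ?case by (rule rec_on_cong) auto
qed (use rec_on_const[of 1 "\<lambda>_. True" 0] in simp)

lemma dec_on_syms [rec_intros]:
  assumes "effective_signature \<sigma>" "rec_on k P F"
  shows "dec_on k P (\<lambda>xs. F xs \<in> syms \<sigma>)"
proof -
  consider m where "syms \<sigma> = {1..m}" | "syms \<sigma> = {1..}"
    using assms(1) by (auto simp: effective_signature_def)
  then show ?thesis
  proof cases
    case 1
    have "dec_on k P (\<lambda>xs. 1 \<le> F xs \<and> F xs \<le> m)" using assms(2) by (intro rec_intros)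
    then show ?thesis by (simp add: 1)
  next
    case 2
    have "dec_on k P (\<lambda>xs. 1 \<le> F xs)" using assms(2) by (intro rec_intros)
    then show ?thesis by (simp add: 2)
  qed
qed

lemma rec1_extend_syms:
  assumes "effective_signature \<sigma>" "\<forall>j\<in>syms \<sigma>. computes f [j] (g j)"
  shows "rec1 (\<lambda>j. if j \<in> syms \<sigma> then g j else 0)"
proof -
  consider m where "syms \<sigma> = {1..m}" | "syms \<sigma> = {1..}"
    using assms(1) by (auto simp: effective_signature_def)
  then show ?thesis
  proof cases
    case 1
    show ?thesis unfolding 1 by (rule rec1_finite_support)
  next
    case 2
    have "rec_on 1 (\<lambda>xs. xs ! 0 \<in> syms \<sigma>) (\<lambda>xs. g (xs ! 0))"
      by (rule rec_onI[of _ _ f]) (use assms(2) in \<open>auto simp: length_Suc_conv\<close>)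
    \<comment> \<open>Only \<open>0\<close> lies outside the signature here. As both branches of a
      conditional get evaluated, the call at \<open>0\<close> is redirected to the symbol
      \<open>1\<close>.\<close>
    then have "rec1 (\<lambda>j. g (if j = 0 then 1 else j))"
      by (rule rec_on_comp1_on) (auto simp: 2 intro!: rec_intros)
    then have "rec1 (\<lambda>j. if j \<in> syms \<sigma> then g (if j = 0 then 1 else j) else 0)"
      by (intro rec_intros assms(1)) auto
    then show ?thesis by (rule rec_on_cong) (auto simp: 2)
  qed
qed

lemma rec1_arity:
  assumes "effective_signature \<sigma>"
  shows "rec1 (\<lambda>j. if j \<in> syms \<sigma> then arity \<sigma> j else 0)"
proof -
  obtain f where "\<forall>j\<in>syms \<sigma>. computes f [j] (arity \<sigma> j)"
    using assms unfolding effective_signature_def by blast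
  from rec1_extend_syms[OF assms this] show ?thesis .
qed

lemma dec_on_is_fun:
  assumes "effective_signature \<sigma>" "rec_on k P F"
  shows "dec_on k P (\<lambda>xs. F xs \<in> syms \<sigma> \<and> is_fun \<sigma> (F xs))"
proof -
  have "rec1 (\<lambda>j. if j \<in> syms \<sigma> then if is_fun \<sigma> j then 1 else 0 else 0)" (is "rec1 ?g")
  proof -
    obtain f where "\<forall>j\<in>syms \<sigma>. computes f [j] (if is_fun \<sigma> j then 1 else 0)"
      using assms(1) unfolding effective_signature_def by blast
    from rec1_extend_syms[OF assms(1) this] show ?thesis .
  qed
  from dec_on_eq[OF rec_on_comp1[OF this assms(2)] rec_on_const] have "dec_on k P (\<lambda>xs. ?g (F xs) = 1)" .
  moreover have "?g j = 1 \<longleftrightarrow> j \<in> syms \<sigma> \<and> is_fun \<sigma> j" for j by simp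
  ultimately show ?thesis by simp
qed

lemma dec_on_fun_sym [rec_intros]:
  assumes "effective_signature \<sigma>" "rec_on k P F" "rec_on k P G"
  shows "dec_on k P (\<lambda>xs. fun_sym \<sigma> (F xs) (G xs))"
proof -
  have "dec_on k P (\<lambda>xs. (F xs \<in> syms \<sigma> \<and> is_fun \<sigma> (F xs)) \<and>
      (if F xs \<in> syms \<sigma> then arity \<sigma> (F xs) else 0) = G xs)"
    using assms by (intro dec_on_conj dec_on_eq dec_on_is_fun rec_on_comp1[OF rec1_arity]) auto
  then show ?thesis
    unfolding dec_on_def by (rule rec_on_cong) (auto simp: fun_sym_def)
qed

lemma dec_on_pred_sym [rec_intros]:
  assumes "effective_signature \<sigma>" "rec_on k P F" "rec_on k P G"
  shows "dec_on k P (\<lambda>xs. pred_sym \<sigma> (F xs) (G xs))"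
proof -
  have "dec_on k P (\<lambda>xs. (F xs \<in> syms \<sigma> \<and> \<not> (F xs \<in> syms \<sigma> \<and> is_fun \<sigma> (F xs))) \<and>
      (if F xs \<in> syms \<sigma> then arity \<sigma> (F xs) else 0) = G xs)"
    using assms by (intro dec_on_conj dec_on_not dec_on_syms dec_on_eq dec_on_is_fun rec_on_comp1[OF rec1_arity]) auto
  then show ?thesis
    unfolding dec_on_def by (rule rec_on_cong) (auto simp: pred_sym_def)
qed

text \<open>The reversals mirror the order in which \<open>cpush\<close> delivers the words; only the set matters.\<close>

primrec path_words :: "ctree \<Rightarrow> nat list list" where
  "path_words (Terminal t) = [[]]"
| "path_words (FunNode e G) = rev (map ((#) (fun_expr_sym e)) (path_words G))"
| "path_words (PredNode p G0 G1) =
     rev (map ((#) (pred_expr_sym p)) (path_words G0)) @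
     rev (map ((#) (pred_expr_sym p)) (path_words G1))"

lemma path_words_neq_Nil: "path_words G \<noteq> []"
  by (induction G) auto

lemma set_path_words: "set (path_words G) = (\<lambda>\<tau>. word (path_exprs \<tau>)) ` complete_paths G"
  by (induction G)
    (simp_all add: word_def path_exprs_def image_image image_Un case_prod_unfold)

lemma tree_complexity_eq: "tree_complexity \<psi> S = Max (\<psi> ` set (path_words (tree_of S)))"
  by (simp add: tree_complexity_def set_path_words image_image)

lemma tree_complexity_le_iff:
  "tree_complexity \<psi> S \<le> B \<longleftrightarrow> (\<forall>w\<in>set (path_words (tree_of S)). \<psi> w \<le> B)"
  by (simp add: tree_complexity_eq path_words_neq_Nil)

lemma path_words_lists: "wf_ctree \<sigma> G \<Longrightarrow> w \<in> set (path_words G) \<Longrightarrow> w \<in> lists (syms_eq \<sigma>)"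
proof (induction G arbitrary: w)
  case (FunNode e G)
  then obtain x where "w = fun_expr_sym e # x" "x \<in> lists (syms_eq \<sigma>)" by auto
  with FunNode.prems show ?case by (cases e) (simp add: fun_sym_def syms_eq_def)
next
  case (PredNode p G0 G1)
  then obtain x where "w = pred_expr_sym p # x" "x \<in> lists (syms_eq \<sigma>)" by auto
  with PredNode.prems show ?case by (cases p) (simp_all add: pred_sym_def syms_eq_def)
qed simp

section \<open>Recognizing codes of expressions and trees\<close>

definition cfun :: "fo_signature \<Rightarrow> nat \<Rightarrow> bool" where
  "cfun \<sigma> e \<longleftrightarrow> clen e = 4 \<and> chd e = 0 \<and> fun_sym \<sigma> (cnth e 2) (clen (cnth e 3))"

definition cpred :: "fo_signature \<Rightarrow> nat \<Rightarrow> bool" where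
  "cpred \<sigma> p \<longleftrightarrow> clen p = 3 \<and>
     (chd p = 1 \<or> chd p = 2 \<and> pred_sym \<sigma> (cnth p 1) (clen (cnth p 2)))"

definition cpred_sym :: "nat \<Rightarrow> nat" where
  "cpred_sym p = (if chd p = 1 then 0 else cnth p 1)"

lemma cfun_code [simp]: "cfun \<sigma> (code_fun_expr e) \<longleftrightarrow> wf_fun_expr \<sigma> e"
  by (cases e) (simp add: cfun_def list_encode_Cons clen_list_encode del: list_encode.simps(2))

lemma cnth_code_fun_expr [simp]: "cnth (code_fun_expr e) 2 = fun_expr_sym e"
  by (cases e) (simp add: list_encode_Cons del: list_encode.simps(2))

lemma cpred_code [simp]: "cpred \<sigma> (code_pred_expr p) \<longleftrightarrow> wf_pred_expr \<sigma> p"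
  by (cases p) (simp_all add: cpred_def list_encode_Cons clen_list_encode del: list_encode.simps(2))

lemma cpred_sym_code [simp]: "cpred_sym (code_pred_expr p) = pred_expr_sym p"
  by (cases p) (simp_all add: cpred_sym_def list_encode_Cons del: list_encode.simps(2))

text \<open>Every number is the code of some list, so the entry for the argument list can always be
  decoded.\<close>

lemma cfun_imp_code:
  assumes "cfun \<sigma> c"
  obtains e where "c = code_fun_expr e"
proof -
  obtain j f l where "c = ccons 0 (ccons j (ccons f (ccons l 0)))"
    using assms by (auto simp: cfun_def numeral_eq_Suc clen_eq_Suc_iff clen_eq_0_iff)
  then have "c = code_fun_expr (Assign j f (list_decode l))"
    by (simp add: ccons_def)
  then show thesis by (rule that)
qed

lemma cpred_imp_code:
  assumes "cpred \<sigma> c"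
  obtains p where "c = code_pred_expr p"
proof -
  obtain t x y where c: "c = ccons t (ccons x (ccons y 0))" and t: "t = 1 \<or> t = 2"
    using assms by (auto simp: cpred_def numeral_eq_Suc clen_eq_Suc_iff clen_eq_0_iff)
  from t have "c = code_pred_expr (EqTest x y) \<or> c = code_pred_expr (RelTest x (list_decode y))"
    by (auto simp: c ccons_def)
  then show thesis using that by blast
qed

text \<open>Course-of-values recursion on the code \<open>c\<close>: the history \<open>h\<close> lists the values at \<open>c - 1, \<dots>, 0\<close>, so the
  value at \<open>i < c\<close> is at position \<open>c - Suc i\<close>. The value is the coded list of the path words if \<open>c\<close>
  is the code of a tree over \<open>\<sigma>\<close>, and \<open>0\<close> otherwise; this is unambiguous since every tree has a path.\<close>

definition cpaths_step :: "fo_signature \<Rightarrow> nat \<Rightarrow> nat \<Rightarrow> nat" where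
  "cpaths_step \<sigma> c h =
    (if chd c = 0 \<and> clen c = 2 then ccons 0 0
     else if chd c = 1 \<and> clen c = 3 \<and> cfun \<sigma> (cnth c 1) \<and> cnth h (c - Suc (cnth c 2)) \<noteq> 0
     then cpush (cnth (cnth c 1) 2) (cnth h (c - Suc (cnth c 2))) 0
     else if chd c = 2 \<and> clen c = 4 \<and> cpred \<sigma> (cnth c 1) \<and>
       cnth h (c - Suc (cnth c 2)) \<noteq> 0 \<and> cnth h (c - Suc (cnth c 3)) \<noteq> 0
     then cpush (cpred_sym (cnth c 1)) (cnth h (c - Suc (cnth c 2)))
       (cpush (cpred_sym (cnth c 1)) (cnth h (c - Suc (cnth c 3))) 0)
     else 0)"

definition chist :: "fo_signature \<Rightarrow> nat \<Rightarrow> nat" where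
  "chist \<sigma> c = rec_nat 0 (\<lambda>n r. ccons (cpaths_step \<sigma> n r) r) c"

definition cpaths :: "fo_signature \<Rightarrow> nat \<Rightarrow> nat" where
  "cpaths \<sigma> c = cpaths_step \<sigma> c (chist \<sigma> c)"

lemma dec_on_cfun: "effective_signature \<sigma> \<Longrightarrow> rec_on k P F \<Longrightarrow> dec_on k P (\<lambda>xs. cfun \<sigma> (F xs))"
  unfolding cfun_def by (intro rec_intros)

lemma dec_on_cpred: "effective_signature \<sigma> \<Longrightarrow> rec_on k P F \<Longrightarrow> dec_on k P (\<lambda>xs. cpred \<sigma> (F xs))"
  unfolding cpred_def by (intro rec_intros)

lemma rec_on_cpred_sym: "rec_on k P F \<Longrightarrow> rec_on k P (\<lambda>xs. cpred_sym (F xs))"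
  unfolding cpred_sym_def by (intro rec_intros)

lemma rec_on_cpaths:
  assumes "effective_signature \<sigma>" "rec_on k P F"
  shows "rec_on k P (\<lambda>xs. cpaths \<sigma> (F xs))"
proof (rule rec_on_comp1[of "cpaths \<sigma>"])
  have "rec2 (cpaths_step \<sigma>)"
    unfolding cpaths_step_def
    by (intro rec_intros dec_on_cfun dec_on_cpred rec_on_cpred_sym assms(1); simp)
  note step = rec_on_comp2[OF this]
  have "rec1 (chist \<sigma>)"
    unfolding chist_def by (intro rec_on_rec_nat rec_intros step; simp)
  then show "rec1 (cpaths \<sigma>)"
    unfolding cpaths_def by (intro step rec_intros) simp_all
qed (fact assms(2))

lemma chist_eq: "chist \<sigma> c = list_encode (map (cpaths \<sigma>) (rev [0..<c]))"
  by (induction c) (simp_all add: chist_def cpaths_def list_encode_Cons del: list_encode.simps(2))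

lemma cnth_chist: "i < c \<Longrightarrow> cnth (chist \<sigma> c) (c - Suc i) = cpaths \<sigma> i"
  by (simp add: chist_eq cnth_list_encode rev_nth)

lemma cpaths_code:
  "wf_ctree \<sigma> G \<Longrightarrow> cpaths \<sigma> (code_ctree G) = list_encode (map list_encode (path_words G))"
proof (induction G)
  case (Terminal t)
  then show ?case
    by (simp add: cpaths_def cpaths_step_def list_encode_Cons del: list_encode.simps(2))
next
  case (FunNode e G)
  define c where "c = code_ctree (FunNode e G)"
  have c: "c = ccons 1 (ccons (code_fun_expr e) (ccons (code_ctree G) 0))"
    by (simp add: c_def ccons_def)
  \<comment> \<open>The code of a subtree is an entry of the code \<open>c\<close> and hence smaller
    than \<open>c\<close>, so its value is in the history.\<close>
  have "cnth (chist \<sigma> c) (c - Suc (cnth c 2)) = cpaths \<sigma> (code_ctree G)"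
    using cnth_less[of 2 c] by (subst cnth_chist) (simp_all add: c)
  moreover have "cpush f (list_encode (map list_encode (path_words G))) 0 =
    list_encode (map list_encode (rev (map ((#) f) (path_words G))))" for f
    using cpush_list_encode[of f "map list_encode (path_words G)" "[]"]
    by (simp add: rev_map list_encode_Cons comp_def del: list_encode.simps(2))
  ultimately have "cpaths \<sigma> c = list_encode (map list_encode (path_words (FunNode e G)))"
    using FunNode unfolding cpaths_def cpaths_step_def
    by (simp add: c list_encode_eq_0_iff path_words_neq_Nil)
  then show ?case by (simp only: c_def)
next
  case (PredNode p G0 G1)
  define c where "c = code_ctree (PredNode p G0 G1)"
  have c: "c = ccons 2 (ccons (code_pred_expr p) (ccons (code_ctree G0) (ccons (code_ctree G1) 0)))"
    by (simp add: c_def ccons_def)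
  have "cnth (chist \<sigma> c) (c - Suc (cnth c 2)) = cpaths \<sigma> (code_ctree G0)"
    using cnth_less[of 2 c] by (subst cnth_chist) (simp_all add: c)
  moreover have "cnth (chist \<sigma> c) (c - Suc (cnth c 3)) = cpaths \<sigma> (code_ctree G1)"
    using cnth_less[of 3 c] by (subst cnth_chist) (simp_all add: c)
  moreover have "cpush f (list_encode (map list_encode (path_words G0)))
      (cpush f (list_encode (map list_encode (path_words G1))) 0) =
    list_encode (map list_encode (rev (map ((#) f) (path_words G0)) @ rev (map ((#) f) (path_words G1))))" for f
    using cpush_list_encode[of f "map list_encode (path_words G1)" "[]"]
    by (simp add: cpush_list_encode rev_map list_encode_Cons comp_def del: list_encode.simps(2))
  ultimately have "cpaths \<sigma> c = list_encode (map list_encode (path_words (PredNode p G0 G1)))"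
    using PredNode unfolding cpaths_def cpaths_step_def
    by (simp add: c list_encode_eq_0_iff path_words_neq_Nil)
  then show ?case by (simp only: c_def)
qed

text \<open>Converse of \<open>cpaths_code\<close>: a nonzero value certifies the code of a tree
  over \<open>\<sigma>\<close>. Strong induction works because entries of a code are smaller than
  the code.\<close>

lemma cpaths_neq_0_imp: "cpaths \<sigma> c \<noteq> 0 \<Longrightarrow> \<exists>G. wf_ctree \<sigma> G \<and> c = code_ctree G"
proof (induction c rule: less_induct)
  case (less c)
  have hist: "cnth (chist \<sigma> c) (c - Suc (cnth c i)) = cpaths \<sigma> (cnth c i)" if "i < clen c" for i
    using that by (intro cnth_chist cnth_less)
  consider "chd c = 0" "clen c = 2"
    | "chd c = 1" "clen c = 3" "cfun \<sigma> (cnth c 1)" "cpaths \<sigma> (cnth c 2) \<noteq> 0"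
    | "chd c = 2" "clen c = 4" "cpred \<sigma> (cnth c 1)" "cpaths \<sigma> (cnth c 2) \<noteq> 0"
      "cpaths \<sigma> (cnth c 3) \<noteq> 0"
    using less.prems hist[of 2] hist[of 3]
    unfolding cpaths_def[of \<sigma> c] cpaths_step_def by (auto split: if_splits)
  then show ?case
  proof cases
    case 1
    then obtain t where "c = ccons 0 (ccons t 0)"
      by (auto simp: numeral_eq_Suc clen_eq_Suc_iff clen_eq_0_iff)
    then show ?thesis by (intro exI[of _ "Terminal t"]) (simp add: ccons_def)
  next
    case 2
    then obtain x y where c: "c = ccons 1 (ccons x (ccons y 0))"
      by (auto simp: numeral_eq_Suc clen_eq_Suc_iff clen_eq_0_iff)
    from 2 less.IH[OF cnth_less, of 2] obtain G where "wf_ctree \<sigma> G" "y = code_ctree G"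
      by (auto simp: c)
    moreover from 2 obtain e where "x = code_fun_expr e" by (auto simp: c elim: cfun_imp_code)
    ultimately show ?thesis using 2
      by (intro exI[of _ "FunNode e G"]) (simp add: c, simp add: ccons_def)
  next
    case 3
    then obtain x y z where c: "c = ccons 2 (ccons x (ccons y (ccons z 0)))"
      by (auto simp: numeral_eq_Suc clen_eq_Suc_iff clen_eq_0_iff)
    from 3 less.IH[OF cnth_less, of 2] obtain G0 where "wf_ctree \<sigma> G0" "y = code_ctree G0"
      by (auto simp: c)
    moreover from 3 less.IH[OF cnth_less, of 3] obtain G1 where "wf_ctree \<sigma> G1" "z = code_ctree G1"
      by (auto simp: c)
    moreover from 3 obtain p where "x = code_pred_expr p" by (auto simp: c elim: cpred_imp_code)
    ultimately show ?thesis using 3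
      by (intro exI[of _ "PredNode p G0 G1"]) (simp add: c, simp add: ccons_def)
  qed
qed

text \<open>A total recursive extension of \<open>\<psi>\<close>, which need not be computable outside the words over \<open>\<sigma>\<close>.\<close>

definition cpsi :: "fo_signature \<Rightarrow> (nat list \<Rightarrow> nat) \<Rightarrow> nat \<Rightarrow> nat" where
  "cpsi \<sigma> \<psi> w = (if list_decode w \<in> lists (syms_eq \<sigma>) then \<psi> (list_decode w) else \<psi> [])"

lemma dec_on_syms_eq [rec_intros]:
  assumes "effective_signature \<sigma>" "rec_on k P F"
  shows "dec_on k P (\<lambda>xs. F xs \<in> syms_eq \<sigma>)"
proof -
  have "dec_on k P (\<lambda>xs. F xs = 0 \<or> F xs \<in> syms \<sigma>)" using assms by (intro rec_intros)
  then show ?thesis by (simp add: syms_eq_def)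
qed

lemma rec_on_cpsi:
  assumes "effective_signature \<sigma>" "strictly_limited \<sigma> \<psi>" "rec_on k P F"
  shows "rec_on k P (\<lambda>xs. cpsi \<sigma> \<psi> (F xs))"
proof (rule rec_on_comp1[of "cpsi \<sigma> \<psi>"])
  obtain f where f: "\<And>w. w \<in> lists (syms_eq \<sigma>) \<Longrightarrow> computes f [list_encode w] (\<psi> w)"
    using assms(2) unfolding strictly_limited_def by blast
  have dec: "list_decode w \<in> lists (syms_eq \<sigma>) \<longleftrightarrow> (\<forall>i<clen w. cnth w i \<in> syms_eq \<sigma>)" for w
    using cnth_list_encode[of _ "list_decode w"] clen_list_encode[of "list_decode w"]
    by (simp add: in_lists_conv_set all_set_conv_all_nth)
  have "rec_on 1 (\<lambda>xs. list_decode (xs ! 0) \<in> lists (syms_eq \<sigma>)) (\<lambda>xs. \<psi> (list_decode (xs ! 0)))"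
  proof (rule rec_onI[of _ _ f])
    fix xs :: "nat list" assume "length xs = 1" "list_decode (xs ! 0) \<in> lists (syms_eq \<sigma>)"
    then show "computes f xs (\<psi> (list_decode (xs ! 0)))"
      using f[of "list_decode (xs ! 0)"] by (auto simp: length_Suc_conv)
  qed
  \<comment> \<open>Codes of other words are first replaced by \<open>0\<close>, the code of the
    empty word, so the algorithm for \<open>\<psi>\<close> is only called where it is known to
    halt.\<close>
  then have "rec1 (\<lambda>w. \<psi> (list_decode (if \<forall>i<clen w. cnth w i \<in> syms_eq \<sigma> then w else 0)))"
    by (rule rec_on_comp1_on[where g = "\<lambda>w. \<psi> (list_decode w)"]) (use assms(1) in \<open>auto simp: dec intro!: rec_intros\<close>)
  then show "rec1 (cpsi \<sigma> \<psi>)"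
    by (rule rec_on_cong) (auto simp: cpsi_def dec)
qed (fact assms(3))

lemma cpsi_list_encode: "w \<in> lists (syms_eq \<sigma>) \<Longrightarrow> cpsi \<sigma> \<psi> (list_encode w) = \<psi> w"
  by (simp add: cpsi_def)

definition cheap_code :: "fo_signature \<Rightarrow> (nat list \<Rightarrow> nat) \<Rightarrow> nat \<Rightarrow> nat \<Rightarrow> bool" where
  "cheap_code \<sigma> \<psi> B c \<longleftrightarrow> (\<exists>S\<in>Tree \<sigma>. c = code_tree_scheme S \<and> tree_complexity \<psi> S \<le> B)"

text \<open>Replaces the quantifier over trees by tests on the number \<open>c\<close>: compute its
  path words and compare the complexity of each with \<open>B\<close>.\<close>

lemma cheap_code_iff:
  "cheap_code \<sigma> \<psi> B c \<longleftrightarrow> clen c = 2 \<and> 1 \<le> chd c \<and> cpaths \<sigma> (cnth c 1) \<noteq> 0 \<and>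
     (\<forall>i<clen (cpaths \<sigma> (cnth c 1)). cpsi \<sigma> \<psi> (cnth (cpaths \<sigma> (cnth c 1)) i) \<le> B)"
  (is "?L \<longleftrightarrow> ?R")
proof -
  have *: "(\<forall>i<clen (cpaths \<sigma> (code_ctree G)). cpsi \<sigma> \<psi> (cnth (cpaths \<sigma> (code_ctree G)) i) \<le> B)
      \<longleftrightarrow> (\<forall>w\<in>set (path_words G). \<psi> w \<le> B)" if "wf_ctree \<sigma> G" for G
    using path_words_lists[OF that]
    by (auto simp: cpaths_code that clen_list_encode cnth_list_encode all_set_conv_all_nth cpsi_list_encode)
  show ?thesis
  proof
    assume ?L
    then obtain n G where "wf_ctree \<sigma> G" "1 \<le> n" "c = ccons n (ccons (code_ctree G) 0)"
      "\<forall>w\<in>set (path_words G). \<psi> w \<le> B"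
      by (auto simp: cheap_code_def Tree_def code_tree_scheme_def tree_complexity_le_iff
          list_encode_Cons simp del: list_encode.simps(2))
    with * show ?R by (auto simp: cpaths_code list_encode_eq_0_iff path_words_neq_Nil)
  next
    assume R: ?R
    then obtain n d where c: "c = ccons n (ccons d 0)"
      by (auto simp: numeral_eq_Suc clen_eq_Suc_iff clen_eq_0_iff)
    with R cpaths_neq_0_imp[of \<sigma> d] obtain G where G: "wf_ctree \<sigma> G" "d = code_ctree G" by auto
    have "1 \<le> n" "\<forall>w\<in>set (path_words G). \<psi> w \<le> B"
      using R *[OF G(1)] by (auto simp: c G(2))
    with G show ?L
      unfolding cheap_code_def
      by (intro bexI[of _ "TreeScheme n G"])
        (auto simp: Tree_def code_tree_scheme_def tree_complexity_le_iff c ccons_def)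
  qed
qed

lemma dec_on_cheap_code:
  assumes "effective_signature \<sigma>" "strictly_limited \<sigma> \<psi>" "rec_on k P F" "rec_on k P G"
  shows "dec_on k P (\<lambda>xs. cheap_code \<sigma> \<psi> (F xs) (G xs))"
proof -
  have "rec2 (\<lambda>B c. of_bool (cheap_code \<sigma> \<psi> B c))"
    unfolding cheap_code_iff
    by (intro rec_intros rec_on_cpaths rec_on_cpsi assms(1,2); simp)
  from rec_on_comp2[OF this assms(3,4)] show ?thesis by (simp add: dec_on_def)
qed

section \<open>Semantics and normalization of computation trees\<close>

primrec exec_fun :: "'a fo_struct \<Rightarrow> fun_expr \<Rightarrow> (nat \<Rightarrow> 'a) \<Rightarrow> (nat \<Rightarrow> 'a)" where
  "exec_fun U (Assign j f ls) v = v(j := fun_of U f (map v ls))"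

primrec exec_pred :: "'a fo_struct \<Rightarrow> pred_expr \<Rightarrow> (nat \<Rightarrow> 'a) \<Rightarrow> bool" where
  "exec_pred U (EqTest l l') v \<longleftrightarrow> v l = v l'"
| "exec_pred U (RelTest r ls) v \<longleftrightarrow> rel_of U r (map v ls)"

primrec run :: "'a fo_struct \<Rightarrow> ctree \<Rightarrow> (nat \<Rightarrow> 'a) \<Rightarrow> nat" where
  "run U (Terminal t) v = t"
| "run U (FunNode e G) v = run U G (exec_fun U e v)"
| "run U (PredNode p G0 G1) v = (if exec_pred U p v then run U G1 v else run U G0 v)"

primrec answers :: "'a fo_struct \<Rightarrow> expr list \<Rightarrow> (nat \<Rightarrow> 'a) \<Rightarrow> bool list" where
  "answers U [] v = []"
| "answers U (b # \<beta>) v =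
     (case b of FunX e \<Rightarrow> answers U \<beta> (exec_fun U e v) | PredX p \<Rightarrow> exec_pred U p v # answers U \<beta> v)"

text \<open>With \<open>sat_pred_atom\<close>, this is the link between the symbolic semantics by
  terms and execution on elements.\<close>

lemma eval_assign_terms:
  "(\<lambda>i. eval_trm U a (assign_terms e M i)) = exec_fun U e (\<lambda>i. eval_trm U a (M i))"
  by (cases e) (auto simp: fun_eq_iff comp_def)

lemma sat_pred_atom: "sat U a (pred_atom M p) \<longleftrightarrow> exec_pred U p (\<lambda>i. eval_trm U a (M i))"
  by (cases p) (auto simp: comp_def)

text \<open>Generalizes \<open>term_seq\<close> to any start \<open>M\<close>, because inductions
  over trees and lists change the start after each step.\<close>

primrec terms_from :: "(nat \<Rightarrow> trm) \<Rightarrow> expr list \<Rightarrow> nat \<Rightarrow> (nat \<Rightarrow> trm)" where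
  "terms_from M \<beta> 0 = M"
| "terms_from M \<beta> (Suc i) = next_terms (\<beta> ! i) (terms_from M \<beta> i)"

lemma term_seq_eq: "term_seq n \<beta> i = terms_from (\<lambda>i. Var (min i (n - 1))) \<beta> i"
  by (induction i) auto

lemma terms_from_Cons: "terms_from M (b # \<beta>) (Suc i) = terms_from (next_terms b M) \<beta> i"
  by (induction i) auto

definition follows :: "'a fo_struct \<Rightarrow> (nat \<Rightarrow> 'a) \<Rightarrow> (nat \<Rightarrow> trm) \<Rightarrow> step list \<Rightarrow> bool" where
  "follows U a M ds \<longleftrightarrow> (\<forall>i<length ds. \<forall>p c. ds ! i = PredStep p c \<longrightarrow>
     sat U a (pred_atom (terms_from M (map step_expr ds) i) p) = c)"

lemma follows_Nil: "follows U a M []"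
  by (simp add: follows_def)

lemma follows_FunStep: "follows U a M (FunStep e # ds) \<longleftrightarrow> follows U a (assign_terms e M) ds"
  unfolding follows_def by (simp add: All_less_Suc2 terms_from_Cons del: terms_from.simps(2))

lemma follows_PredStep:
  "follows U a M (PredStep p c # ds) \<longleftrightarrow> sat U a (pred_atom M p) = c \<and> follows U a M ds"
  unfolding follows_def by (auto simp: All_less_Suc2 terms_from_Cons simp del: terms_from.simps(2))

lemma path_literals_follows:
  "(\<forall>\<alpha>\<in>path_literals n \<tau>. true_on U as \<alpha>) \<longleftrightarrow>
     follows U (\<lambda>i. as ! i) (\<lambda>i. Var (min i (n - 1))) (fst \<tau>)"
  unfolding path_literals_def follows_def
  by (fastforce simp: kappa_def path_exprs_def term_seq_eq true_on_def literal_def)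

text \<open>One equivalence yields existence, uniqueness and the terminal label of the path that is
  followed, as needed to evaluate the \<open>THE\<close> in \<open>tree_value\<close>.\<close>

lemma complete_path_unique:
  "\<exists>ds. \<forall>\<tau>. \<tau> \<in> complete_paths G \<and> follows U a M (fst \<tau>) \<longleftrightarrow>
     \<tau> = (ds, run U G (\<lambda>i. eval_trm U a (M i)))"
proof (induction G arbitrary: M)
  case (Terminal t)
  show ?case by (rule exI[of _ "[]"]) (auto simp: follows_Nil)
next
  case (FunNode e G)
  from FunNode[of "assign_terms e M"] obtain ds where
    ds: "\<tau> \<in> complete_paths G \<and> follows U a (assign_terms e M) (fst \<tau>) \<longleftrightarrow>
      \<tau> = (ds, run U (FunNode e G) (\<lambda>i. eval_trm U a (M i)))" for \<tau>
    unfolding eval_assign_terms by auto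
  show ?case
  proof (rule exI[of _ "FunStep e # ds"], rule allI)
    fix \<tau> :: path
    obtain es t where \<tau>: "\<tau> = (es, t)" by (cases \<tau>)
    have "\<exists>ds'. es = FunStep e # ds'" if "\<tau> \<in> complete_paths (FunNode e G)"
      using that by (auto simp: \<tau>)
    moreover have "(FunStep e # ds', t) \<in> complete_paths (FunNode e G) \<longleftrightarrow> (ds', t) \<in> complete_paths G"
      for ds' t
      by (auto simp: image_iff split: prod.splits)
    ultimately show "\<tau> \<in> complete_paths (FunNode e G) \<and> follows U a M (fst \<tau>) \<longleftrightarrow>
      \<tau> = (FunStep e # ds, run U (FunNode e G) (\<lambda>i. eval_trm U a (M i)))"
      using ds \<tau> follows_FunStep by (metis fst_conv list.inject prod.inject)
  qed
next
  case (PredNode p G0 G1)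
  define c where "c = exec_pred U p (\<lambda>i. eval_trm U a (M i))"
  \<comment> \<open>The only subtree that a followed path can enter.\<close>
  define G where "G = (if c then G1 else G0)"
  from PredNode[of M] obtain ds where
    ds: "\<tau> \<in> complete_paths G \<and> follows U a M (fst \<tau>) \<longleftrightarrow>
      \<tau> = (ds, run U (PredNode p G0 G1) (\<lambda>i. eval_trm U a (M i)))" for \<tau>
    unfolding G_def c_def by (cases c) (auto simp: c_def)
  have paths: "(PredStep p c # ds', t) \<in> complete_paths (PredNode p G0 G1) \<longleftrightarrow> (ds', t) \<in> complete_paths G" for ds' t
    by (auto simp: G_def image_iff split: prod.splits)
  show ?case
  proof (rule exI[of _ "PredStep p c # ds"], rule allI)
    fix \<tau> :: path
    obtain es t where \<tau>: "\<tau> = (es, t)" by (cases \<tau>)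
    have "\<exists>ds'. es = PredStep p c # ds'" if "\<tau> \<in> complete_paths (PredNode p G0 G1)" "follows U a M (fst \<tau>)"
      using that by (auto simp: \<tau> c_def follows_PredStep sat_pred_atom)
    moreover have "follows U a M (PredStep p c # ds') \<longleftrightarrow> follows U a M ds'" for ds'
      by (simp add: follows_PredStep sat_pred_atom c_def)
    ultimately show "\<tau> \<in> complete_paths (PredNode p G0 G1) \<and> follows U a M (fst \<tau>) \<longleftrightarrow>
      \<tau> = (PredStep p c # ds, run U (PredNode p G0 G1) (\<lambda>i. eval_trm U a (M i)))"
      using paths ds \<tau> by (metis fst_conv list.inject prod.inject)
  qed
qed

lemma tree_value_eq_run: "tree_value S U as = run U (tree_of S) (\<lambda>i. as ! min i (tree_dim S - 1))"
proof -
  let ?M = "\<lambda>i. Var (min i (tree_dim S - 1))"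
  obtain ds where "\<tau> \<in> complete_paths (tree_of S) \<and> follows U (\<lambda>i. as ! i) ?M (fst \<tau>) \<longleftrightarrow>
      \<tau> = (ds, run U (tree_of S) (\<lambda>i. as ! min i (tree_dim S - 1)))" for \<tau>
    using complete_path_unique[of "tree_of S" U "\<lambda>i. as ! i" ?M] by auto
  then show ?thesis by (simp add: tree_value_def path_literals_follows)
qed

lemma pred_positions_Cons:
  "pred_positions (b # \<beta>) = (if is_PredX b then [0] else []) @ map Suc (pred_positions \<beta>)"
proof -
  have "[0..<length (b # \<beta>)] = 0 # map Suc [0..<length \<beta>]"
    by (simp add: map_Suc_upt upt_conv_Cons del: upt_Suc)
  then show ?thesis by (simp add: pred_positions_def filter_map comp_def del: upt_Suc)
qed

lemma answers_eq:
  "map (\<lambda>i. sat U a (pred_atom (terms_from M \<beta> i) (the_pred (\<beta> ! i)))) (pred_positions \<beta>) =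
     answers U \<beta> (\<lambda>i. eval_trm U a (M i))"
proof (induction \<beta> arbitrary: M)
  case Nil
  show ?case by (simp add: pred_positions_def)
next
  case (Cons b \<beta>)
  show ?case
    using Cons[of "next_terms b M"]
    by (cases b) (simp_all add: pred_positions_Cons terms_from_Cons eval_assign_terms sat_pred_atom
        comp_def del: terms_from.simps(2))
qed

lemma probl_value_eq_answers:
  "probl_value s U as =
     probl_fun s (answers U (probl_exprs s) (\<lambda>i. as ! min i (probl_dim s - 1)))"
  using answers_eq[of U "\<lambda>i. as ! i" "\<lambda>i. Var (min i (probl_dim s - 1))" "probl_exprs s"]
  by (simp add: probl_value_def kappa_def true_on_def term_seq_eq)

lemma solves_iff:
  "solves S s C \<longleftrightarrow> tree_dim S = probl_dim s \<and>
     (\<forall>U\<in>C. \<forall>as\<in>tuples (univ U) (probl_dim s).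
        run U (tree_of S) (\<lambda>i. as ! min i (probl_dim s - 1)) = probl_value s U as)"
  by (auto simp: solves_def tree_value_eq_run)

section \<open>A tree solving a given problem, and bounds read off the code of the problem\<close>

primrec problem_tree :: "expr list \<Rightarrow> (bool list \<Rightarrow> nat) \<Rightarrow> ctree" where
  "problem_tree [] \<nu> = Terminal (\<nu> [])"
| "problem_tree (b # \<beta>) \<nu> =
     (case b of FunX e \<Rightarrow> FunNode e (problem_tree \<beta> \<nu>)
      | PredX p \<Rightarrow> PredNode p (problem_tree \<beta> (\<lambda>cs. \<nu> (False # cs)))
                              (problem_tree \<beta> (\<lambda>cs. \<nu> (True # cs))))"

text \<open>At each predicate node \<open>\<nu>\<close> is specialized to the answer received, so
  the induction has to vary \<open>\<nu>\<close>.\<close>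

lemma run_problem_tree: "run U (problem_tree \<beta> \<nu>) v = \<nu> (answers U \<beta> v)"
  by (induction \<beta> arbitrary: \<nu> v) (auto split: expr.splits)

lemma wf_problem_tree: "\<forall>b\<in>set \<beta>. wf_expr \<sigma> b \<Longrightarrow> wf_ctree \<sigma> (problem_tree \<beta> \<nu>)"
  by (induction \<beta> arbitrary: \<nu>) (auto split: expr.splits)

lemma ex_solving_tree:
  assumes "s \<in> Probl \<sigma>"
  shows "\<exists>S\<in>Tree \<sigma>. solves S s C"
  using assms
  by (intro bexI[of _ "TreeScheme (probl_dim s) (problem_tree (probl_exprs s) (probl_fun s))"])
    (auto simp: Probl_def Tree_def solves_iff run_problem_tree probl_value_eq_answers
      intro: wf_problem_tree)

text \<open>The code of \<open>s\<close> contains the table of values of \<open>\<nu>\<close>, and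
  the code of a list exceeds its entries.\<close>

lemma probl_value_less_code: "probl_value s U as < code_problem_scheme s"
proof -
  let ?k = "length (pred_positions (probl_exprs s))"
  let ?t = "map (probl_fun s) (List.n_lists ?k [False, True])"
  have "probl_value s U as \<in> set ?t"
    unfolding probl_value_def set_map by (rule imageI) (auto simp: set_n_lists)
  then have "probl_value s U as < list_encode ?t" by (rule mem_less_list_encode)
  also have "\<dots> < code_problem_scheme s"
    unfolding code_problem_scheme_def by (rule mem_less_list_encode) simp
  finally show ?thesis .
qed

lemma probl_dim_less_code: "probl_dim s < code_problem_scheme s"
  unfolding code_problem_scheme_def by (rule mem_less_list_encode) simp

section \<open>Renaming variables and truncating labels\<close>

primrec rename_fun :: "(nat \<Rightarrow> nat) \<Rightarrow> fun_expr \<Rightarrow> fun_expr" where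
  "rename_fun \<pi> (Assign j f ls) = Assign (\<pi> j) f (map \<pi> ls)"

primrec rename_pred :: "(nat \<Rightarrow> nat) \<Rightarrow> pred_expr \<Rightarrow> pred_expr" where
  "rename_pred \<pi> (EqTest l l') = EqTest (\<pi> l) (\<pi> l')"
| "rename_pred \<pi> (RelTest r ls) = RelTest r (map \<pi> ls)"

primrec rename_expr :: "(nat \<Rightarrow> nat) \<Rightarrow> expr \<Rightarrow> expr" where
  "rename_expr \<pi> (FunX e) = FunX (rename_fun \<pi> e)"
| "rename_expr \<pi> (PredX p) = PredX (rename_pred \<pi> p)"

primrec normalize_tree :: "(nat \<Rightarrow> nat) \<Rightarrow> nat \<Rightarrow> ctree \<Rightarrow> ctree" where
  "normalize_tree \<pi> L (Terminal t) = Terminal (min t L)"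
| "normalize_tree \<pi> L (FunNode e G) = FunNode (rename_fun \<pi> e) (normalize_tree \<pi> L G)"
| "normalize_tree \<pi> L (PredNode p G0 G1) =
     PredNode (rename_pred \<pi> p) (normalize_tree \<pi> L G0) (normalize_tree \<pi> L G1)"

lemma exec_rename_fun:
  "inj \<pi> \<Longrightarrow> (\<lambda>i. exec_fun U (rename_fun \<pi> e) v (\<pi> i)) = exec_fun U e (\<lambda>i. v (\<pi> i))"
  by (cases e) (auto simp: fun_eq_iff comp_def inj_eq)

lemma exec_rename_pred: "exec_pred U (rename_pred \<pi> p) v = exec_pred U p (\<lambda>i. v (\<pi> i))"
  by (cases p) (auto simp: comp_def)

text \<open>Injectivity ensures that an assignment to \<open>\<pi> j\<close> overwrites no other
  renamed variable.\<close>

lemma run_normalize_tree: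
  "inj \<pi> \<Longrightarrow> run U (normalize_tree \<pi> L G) v = min (run U G (\<lambda>i. v (\<pi> i))) L"
  by (induction G arbitrary: v) (simp_all add: exec_rename_fun exec_rename_pred)

lemma rename_fun_sym [simp]: "fun_expr_sym (rename_fun \<pi> e) = fun_expr_sym e"
  by (cases e) simp

lemma rename_pred_sym [simp]: "pred_expr_sym (rename_pred \<pi> p) = pred_expr_sym p"
  by (cases p) simp_all

lemma rename_expr_sym [simp]: "expr_sym (rename_expr \<pi> b) = expr_sym b"
  by (cases b) simp_all

lemma wf_rename_fun [simp]: "wf_fun_expr \<sigma> (rename_fun \<pi> e) = wf_fun_expr \<sigma> e"
  by (cases e) simp

lemma wf_rename_pred [simp]: "wf_pred_expr \<sigma> (rename_pred \<pi> p) = wf_pred_expr \<sigma> p"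
  by (cases p) simp_all

lemma path_words_normalize_tree: "path_words (normalize_tree \<pi> L G) = path_words G"
  by (induction G) simp_all

lemma wf_normalize_tree: "wf_ctree \<sigma> (normalize_tree \<pi> L G) = wf_ctree \<sigma> G"
  by (induction G) simp_all

section \<open>Height, symbols and variables of a tree\<close>

primrec tree_exprs :: "ctree \<Rightarrow> expr set" where
  "tree_exprs (Terminal t) = {}"
| "tree_exprs (FunNode e G) = insert (FunX e) (tree_exprs G)"
| "tree_exprs (PredNode p G0 G1) = insert (PredX p) (tree_exprs G0 \<union> tree_exprs G1)"

primrec labels :: "ctree \<Rightarrow> nat set" where
  "labels (Terminal t) = {t}"
| "labels (FunNode e G) = labels G"
| "labels (PredNode p G0 G1) = labels G0 \<union> labels G1"

primrec height :: "ctree \<Rightarrow> nat" where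
  "height (Terminal t) = 0"
| "height (FunNode e G) = Suc (height G)"
| "height (PredNode p G0 G1) = Suc (max (height G0) (height G1))"

primrec fun_vars :: "fun_expr \<Rightarrow> nat list" where
  "fun_vars (Assign j f ls) = j # ls"

primrec pred_vars :: "pred_expr \<Rightarrow> nat list" where
  "pred_vars (EqTest l l') = [l, l']"
| "pred_vars (RelTest r ls) = ls"

primrec expr_vars :: "expr \<Rightarrow> nat list" where
  "expr_vars (FunX e) = fun_vars e"
| "expr_vars (PredX p) = pred_vars p"

lemma expr_vars_rename: "expr_vars (rename_expr \<pi> b) = map \<pi> (expr_vars b)"
proof (cases b)
  case (FunX e)
  then show ?thesis by (cases e) simp
next
  case (PredX p)
  then show ?thesis by (cases p) simp_all
qed

lemma tree_exprs_normalize: "tree_exprs (normalize_tree \<pi> L G) = rename_expr \<pi> ` tree_exprs G"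
  by (induction G) auto

lemma labels_normalize: "x \<in> labels (normalize_tree \<pi> L G) \<Longrightarrow> x \<le> L"
  by (induction G) auto

lemma height_normalize: "height (normalize_tree \<pi> L G) = height G"
  by (induction G) simp_all

lemma finite_tree_exprs: "finite (tree_exprs G)"
  by (induction G) simp_all

lemma wf_tree_exprs: "wf_ctree \<sigma> G \<Longrightarrow> b \<in> tree_exprs G \<Longrightarrow> wf_expr \<sigma> b"
  by (induction G) auto

lemma height_le_path_length:
  "(\<And>w. w \<in> set (path_words G) \<Longrightarrow> length w \<le> B) \<Longrightarrow> height G \<le> B"
proof (induction G arbitrary: B)
  case (FunNode e G)
  obtain w where "w \<in> set (path_words G)" using path_words_neq_Nil[of G] by (cases "path_words G") auto
  \<comment> \<open>Some path passes the root, so \<open>B\<close> is positive and the subtree can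
    be treated with \<open>B - 1\<close>.\<close>
  then have B: "B = Suc (B - 1)" using FunNode.prems[of "fun_expr_sym e # w"] by simp
  have "length w \<le> B - 1" if "w \<in> set (path_words G)" for w
    using FunNode.prems[of "fun_expr_sym e # w"] that by simp
  then have "height G \<le> B - 1" by (rule FunNode.IH)
  with B show ?case by simp
next
  case (PredNode p G0 G1)
  obtain w where "w \<in> set (path_words G0)" using path_words_neq_Nil[of G0] by (cases "path_words G0") auto
  then have B: "B = Suc (B - 1)" using PredNode.prems[of "pred_expr_sym p # w"] by simp
  have "length w \<le> B - 1" if "w \<in> set (path_words G0) \<union> set (path_words G1)" for w
    using PredNode.prems[of "pred_expr_sym p # w"] that by fastforce
  then have "height G0 \<le> B - 1" "height G1 \<le> B - 1" by (auto intro: PredNode.IH)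
  with B show ?case by simp
qed simp

text \<open>Every node lies on a complete path, since each subtree has one.\<close>

lemma expr_sym_on_path: "b \<in> tree_exprs G \<Longrightarrow> \<exists>w\<in>set (path_words G). expr_sym b \<in> set w"
proof (induction G)
  case (FunNode e G)
  obtain w where "w \<in> set (path_words G)" using path_words_neq_Nil[of G] by (cases "path_words G") auto
  with FunNode show ?case by (auto simp: bex_Un)
next
  case (PredNode p G0 G1)
  obtain w where "w \<in> set (path_words G0)" using path_words_neq_Nil[of G0] by (cases "path_words G0") auto
  with PredNode show ?case by (auto simp: bex_Un)
qed simp

text \<open>A tree of height \<open>h\<close> has at most \<open>2 ^ h - 1\<close> inner nodes with
  at most \<open>X\<close> variables each. The summand \<open>X\<close> on the left avoids the
  subtraction and carries the induction.\<close>

lemma card_tree_vars: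
  assumes "\<And>b. b \<in> tree_exprs G \<Longrightarrow> length (expr_vars b) \<le> X"
  shows "card (\<Union>b\<in>tree_exprs G. set (expr_vars b)) + X \<le> 2 ^ height G * X"
  using assms
proof (induction G)
  case (FunNode e G)
  let ?V = "\<Union>b\<in>tree_exprs G. set (expr_vars b)"
  have "card (set (fun_vars e) \<union> ?V) \<le> card (set (fun_vars e)) + card ?V"
    by (rule card_Un_le)
  moreover have "card (set (fun_vars e)) \<le> X"
    using card_length[of "fun_vars e"] FunNode.prems[of "FunX e"] by simp
  moreover have "card ?V + X \<le> 2 ^ height G * X" using FunNode by simp
  ultimately show ?case by simp
next
  case (PredNode p G0 G1)
  let ?V0 = "\<Union>b\<in>tree_exprs G0. set (expr_vars b)" and ?V1 = "\<Union>b\<in>tree_exprs G1. set (expr_vars b)"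
  have "card (set (pred_vars p) \<union> (?V0 \<union> ?V1)) \<le> card (set (pred_vars p)) + (card ?V0 + card ?V1)"
    by (meson add_left_mono card_Un_le le_trans)
  moreover have "card (set (pred_vars p)) \<le> X"
    using card_length[of "pred_vars p"] PredNode.prems[of "PredX p"] by simp
  moreover have "card ?V0 + X \<le> 2 ^ height G0 * X" "card ?V1 + X \<le> 2 ^ height G1 * X"
    using PredNode by simp_all
  moreover have "2 ^ height G0 * X \<le> 2 ^ max (height G0) (height G1) * X"
    "2 ^ height G1 * X \<le> 2 ^ max (height G0) (height G1) * X"
    by (simp_all add: mult_le_mono1)
  ultimately have "card (set (pred_vars p) \<union> (?V0 \<union> ?V1)) + X \<le>
      2 * (2 ^ max (height G0) (height G1) * X)"
    by linarith
  then show ?case by (simp add: UN_Un mult.assoc)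
qed simp

text \<open>All variables with index at least \<open>n\<close> start with the value of
  \<open>x_{n-1}\<close>. A renaming therefore respects the start if it fixes the indices below
  \<open>n\<close> and keeps the others out of that range.\<close>

lemma ex_compressing_injection:
  fixes V :: "nat set"
  assumes "finite V"
  obtains \<pi> where "inj \<pi>" "\<And>i. i < n \<Longrightarrow> \<pi> i = i" "\<And>i. n \<le> i \<Longrightarrow> n \<le> \<pi> i"
    "\<And>i. i \<in> V \<Longrightarrow> \<pi> i < n + card V"
proof -
  obtain h where h: "bij_betw h V {0..<card V}"
    using ex_bij_betw_finite_nat[OF assms] by blast
  \<comment> \<open>The part of \<open>V\<close> from \<open>n\<close> on goes into the
    \<open>card V\<close> places after \<open>n\<close>; all remaining indices are shifted behind
    this block to keep the map injective.\<close>
  define \<pi> where "\<pi> i = (if i < n then i else if i \<in> V then n + h i else n + card V + i)" for i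
  have h_less: "h i < card V" if "i \<in> V" for i
    using h that by (auto simp: bij_betw_def)
  show thesis
  proof
    show "inj \<pi>"
    proof (rule injI)
      fix i j assume "\<pi> i = \<pi> j"
      then show "i = j"
        using h_less[of i] h_less[of j] bij_betw_imp_inj_on[OF h]
        by (auto simp: \<pi>_def inj_on_eq_iff split: if_splits)
    qed
  qed (use h_less in \<open>auto simp: \<pi>_def\<close>)
qed

section \<open>Bounds on codes\<close>

lemma prod_encode_mono:
  assumes "a \<le> a'" "b \<le> b'"
  shows "prod_encode (a, b) \<le> prod_encode (a', b')"
proof -
  have "triangle m \<le> triangle n" if "m \<le> n" for m n
    using that by (induction rule: dec_induct) simp_all
  then show ?thesis using assms by (simp add: prod_encode_def add_mono)
qed

text \<open>The code of the list of \<open>k\<close> copies of \<open>v\<close>, which is the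
  largest code of a list of at most \<open>k\<close> entries not exceeding \<open>v\<close>.\<close>

definition list_bound :: "nat \<Rightarrow> nat \<Rightarrow> nat" where
  "list_bound v k = rec_nat 0 (\<lambda>_ r. ccons v r) k"

lemma list_encode_le_list_bound:
  "length xs \<le> k \<Longrightarrow> \<forall>x\<in>set xs. x \<le> v \<Longrightarrow> list_encode xs \<le> list_bound v k"
proof (induction xs arbitrary: k)
  case (Cons x xs)
  then obtain k' where "k = Suc k'" by (cases k) auto
  with Cons show ?case by (auto simp: list_bound_def ccons_def intro: prod_encode_mono)
qed simp

text \<open>The summand \<open>v\<close> in front makes the bound at least \<open>v\<close>, so it
  also covers labels and node tags in \<open>tree_bound\<close>. No code of an expression has more
  than \<open>4\<close> entries.\<close>

definition expr_bound :: "nat \<Rightarrow> nat \<Rightarrow> nat" where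
  "expr_bound v k = v + list_bound (v + list_bound v k) 4"

definition tree_bound :: "nat \<Rightarrow> nat \<Rightarrow> nat \<Rightarrow> nat" where
  "tree_bound v k d = rec_nat (list_bound v 2) (\<lambda>_ r. list_bound (expr_bound v k + r) 4) d"

lemma code_fun_expr_le:
  assumes "2 \<le> v" "fun_expr_sym e \<le> v" "\<forall>i\<in>set (fun_vars e). i \<le> v" "length (fun_vars e) \<le> k"
  shows "code_fun_expr e \<le> expr_bound v k"
proof (cases e)
  case (Assign j f ls)
  then have "list_encode ls \<le> list_bound v k"
    using assms by (intro list_encode_le_list_bound) auto
  with Assign assms show ?thesis
    unfolding expr_bound_def code_fun_expr.simps
    by (simp del: list_encode.simps(2)) (intro trans_le_add2 list_encode_le_list_bound, auto)
qed

lemma code_pred_expr_le: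
  assumes "2 \<le> v" "pred_expr_sym p \<le> v" "\<forall>i\<in>set (pred_vars p). i \<le> v" "length (pred_vars p) \<le> k"
  shows "code_pred_expr p \<le> expr_bound v k"
proof (cases p)
  case (EqTest l l')
  with assms show ?thesis
    unfolding expr_bound_def
    by (simp del: list_encode.simps(2)) (intro trans_le_add2 list_encode_le_list_bound, auto)
next
  case (RelTest r ls)
  then have "list_encode ls \<le> list_bound v k"
    using assms by (intro list_encode_le_list_bound) auto
  with RelTest assms show ?thesis
    unfolding expr_bound_def
    by (simp del: list_encode.simps(2)) (intro trans_le_add2 list_encode_le_list_bound, auto)
qed

lemma code_ctree_le:
  assumes "2 \<le> v" "height G \<le> d" "\<forall>t\<in>labels G. t \<le> v"
    "\<And>b. b \<in> tree_exprs G \<Longrightarrow>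
      expr_sym b \<le> v \<and> (\<forall>i\<in>set (expr_vars b). i \<le> v) \<and> length (expr_vars b) \<le> k"
  shows "code_ctree G \<le> tree_bound v k d"
  using assms(2-)
proof (induction G arbitrary: d)
  case (Terminal t)
  show ?case
  proof (cases d)
    case 0
    have "list_encode [0, t] \<le> list_bound v 2"
      using Terminal by (intro list_encode_le_list_bound) auto
    then show ?thesis by (simp add: tree_bound_def 0)
  next
    case (Suc d')
    \<comment> \<open>\<open>d\<close> only bounds the height, so a leaf must also fit under the
      bound for positive depth.\<close>
    have "list_encode [0, t] \<le> list_bound (expr_bound v k + tree_bound v k d') 4"
      using Terminal by (intro list_encode_le_list_bound) (auto simp: expr_bound_def)
    then show ?thesis by (simp add: tree_bound_def Suc)
  qed
next
  case (FunNode e G)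
  then obtain d' where d: "d = Suc d'" by (cases d) auto
  have "code_ctree G \<le> tree_bound v k d'"
    using FunNode.prems by (intro FunNode.IH) (auto simp: d)
  moreover have "code_fun_expr e \<le> expr_bound v k"
    using FunNode.prems(3)[of "FunX e"] assms(1) by (intro code_fun_expr_le) auto
  moreover have "1 \<le> expr_bound v k" using assms(1) by (simp add: expr_bound_def)
  ultimately have "list_encode [1, code_fun_expr e, code_ctree G] \<le>
      list_bound (expr_bound v k + tree_bound v k d') 4"
    by (intro list_encode_le_list_bound) auto
  then show ?case by (simp add: tree_bound_def d)
next
  case (PredNode p G0 G1)
  then obtain d' where d: "d = Suc d'" by (cases d) auto
  have "code_ctree G0 \<le> tree_bound v k d'" "code_ctree G1 \<le> tree_bound v k d'"
    using PredNode.prems by (auto intro!: PredNode.IH simp: d)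
  moreover have "code_pred_expr p \<le> expr_bound v k"
    using PredNode.prems(3)[of "PredX p"] assms(1) by (intro code_pred_expr_le) auto
  moreover have "2 \<le> expr_bound v k" using assms(1) by (simp add: expr_bound_def)
  ultimately have "list_encode [2, code_pred_expr p, code_ctree G0, code_ctree G1] \<le>
      list_bound (expr_bound v k + tree_bound v k d') 4"
    by (intro list_encode_le_list_bound) auto
  then show ?case by (simp add: tree_bound_def d)
qed

text \<open>\<open>m\<close> bounds the symbols, \<open>A\<close> their arities and \<open>s\<close> the labels and the dimension; a tree of depth \<open>B\<close>
  has less than \<open>2 ^ B\<close> inner nodes, with at most \<open>A + 2\<close> variables each.\<close>

definition scheme_bound :: "nat \<Rightarrow> nat \<Rightarrow> nat \<Rightarrow> nat \<Rightarrow> nat" where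
  "scheme_bound B m A s =
     (let v = s + m + 2 ^ B * (A + 2) + 2 in list_bound (v + tree_bound v (A + 2) B) 2)"

section \<open>Consequences of strict monotonicity for trees of bounded complexity\<close>

lemma strictly_limited_less:
  assumes "strictly_limited \<sigma> \<psi>" "w1 \<in> lists (syms_eq \<sigma>)" "w2 \<in> lists (syms_eq \<sigma>)"
    "w3 \<in> lists (syms_eq \<sigma>)" "w2 \<noteq> []"
  shows "\<psi> (w1 @ w3) < \<psi> (w1 @ w2 @ w3)"
  using assms unfolding strictly_limited_def by blast

text \<open>Each further symbol raises \<open>\<psi>\<close> by at least one.\<close>

lemma length_le_psi:
  assumes "strictly_limited \<sigma> \<psi>" "w \<in> lists (syms_eq \<sigma>)"
  shows "length w \<le> \<psi> w"
  using assms(2)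
proof (induction w)
  case (Cons x w)
  then show ?case using strictly_limited_less[OF assms(1), of "[]" "[x]" w] by simp
qed simp

text \<open>Adding first the symbols after \<open>x\<close> and then those before it never lowers
  \<open>\<psi>\<close>.\<close>

lemma psi_symbol_le:
  assumes "strictly_limited \<sigma> \<psi>" "w \<in> lists (syms_eq \<sigma>)" "x \<in> set w"
  shows "\<psi> [x] \<le> \<psi> w"
proof -
  note less = strictly_limited_less[OF assms(1)]
  obtain u v where w: "w = u @ x # v" using assms(3) by (meson split_list)
  have mem: "u \<in> lists (syms_eq \<sigma>)" "v \<in> lists (syms_eq \<sigma>)" "[x] \<in> lists (syms_eq \<sigma>)"
    using assms(2) by (simp_all add: w)
  have "\<psi> [x] \<le> \<psi> (x # v)"
    using less[of "[x]" v "[]"] mem by (cases "v = []") auto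
  also have "\<dots> \<le> \<psi> w"
    using less[of "[]" u "x # v"] mem w by (cases "u = []") auto
  finally show ?thesis .
qed

lemma ex_small_solving_tree:
  assumes sl: "strictly_limited \<sigma> \<psi>" and S: "S \<in> Tree \<sigma>" "solves S s C" "tree_complexity \<psi> S \<le> B"
    and m: "\<And>j. j \<in> syms_eq \<sigma> \<Longrightarrow> \<psi> [j] \<le> B \<Longrightarrow> j < m"
    and A: "\<And>j. j \<in> syms \<sigma> \<Longrightarrow> j < m \<Longrightarrow> arity \<sigma> j \<le> A"
  shows "\<exists>S'\<in>Tree \<sigma>. solves S' s C \<and> tree_complexity \<psi> S' \<le> B \<and>
    code_tree_scheme S' \<le> scheme_bound B m A (code_problem_scheme s)"
proof -
  define G where "G = tree_of S"
  define n where "n = probl_dim s"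
  define cs where "cs = code_problem_scheme s"
  have n: "tree_dim S = n" "1 \<le> n" using S by (auto simp: solves_iff Tree_def n_def)
  have wf: "wf_ctree \<sigma> G" using S by (simp add: Tree_def G_def)
  have psi: "\<psi> w \<le> B" if "w \<in> set (path_words G)" for w
    using S(3) that by (simp add: tree_complexity_le_iff G_def)
  have height: "height G \<le> B"
    using psi length_le_psi[OF sl path_words_lists[OF wf]] by (intro height_le_path_length) force
  have sym: "expr_sym b < m" if b: "b \<in> tree_exprs G" for b
  proof -
    obtain w where w: "w \<in> set (path_words G)" "expr_sym b \<in> set w"
      using expr_sym_on_path[OF b] by blast
    have "w \<in> lists (syms_eq \<sigma>)" using path_words_lists[OF wf w(1)] .
    with w psi[OF w(1)] psi_symbol_le[OF sl this w(2)] show ?thesis by (intro m) auto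
  qed
  \<comment> \<open>A function expression has a target besides its arguments, and an equality test
    has two variables whatever \<open>A\<close> is; \<open>A + 2\<close> covers both.\<close>
  have len: "length (expr_vars b) \<le> A + 2" if b: "b \<in> tree_exprs G" for b
  proof (cases b)
    case (FunX e)
    with wf_tree_exprs[OF wf b] sym[OF b] A show ?thesis by (cases e) (force simp: fun_sym_def)
  next
    case (PredX p)
    with wf_tree_exprs[OF wf b] sym[OF b] A show ?thesis by (cases p) (force simp: pred_sym_def)+
  qed
  define V where "V = (\<Union>b\<in>tree_exprs G. set (expr_vars b))"
  have "finite V" by (simp add: V_def finite_tree_exprs)
  then obtain \<pi> where \<pi>: "inj \<pi>" "\<And>i. i < n \<Longrightarrow> \<pi> i = i" "\<And>i. n \<le> i \<Longrightarrow> n \<le> \<pi> i"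
    "\<And>i. i \<in> V \<Longrightarrow> \<pi> i < n + card V"
    using ex_compressing_injection[of V n] by metis
  have "card V \<le> 2 ^ height G * (A + 2)"
    using card_tree_vars[OF len, of G] by (simp add: V_def)
  also have "\<dots> \<le> 2 ^ B * (A + 2)" using height by (intro mult_le_mono1 power_increasing) auto
  finally have card: "card V \<le> 2 ^ B * (A + 2)" .
  have n_le: "n < cs" using probl_dim_less_code by (simp add: n_def cs_def)
  define v where "v = cs + m + 2 ^ B * (A + 2) + 2"
  \<comment> \<open>Every value of the problem is below \<open>cs\<close>, so truncating labels at
    \<open>cs\<close> changes no correct answer.\<close>
  define G' where "G' = normalize_tree \<pi> cs G"
  have vars: "\<pi> i \<le> v" if "i \<in> V" for i
    using \<pi>(4)[OF that] card n_le by (simp add: v_def)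
  have "code_ctree G' \<le> tree_bound v (A + 2) B"
  proof (rule code_ctree_le)
    show "height G' \<le> B" using height by (simp add: G'_def height_normalize)
    show "\<forall>t\<in>labels G'. t \<le> v" using labels_normalize by (fastforce simp: G'_def v_def)
    show "expr_sym b \<le> v \<and> (\<forall>i\<in>set (expr_vars b). i \<le> v) \<and> length (expr_vars b) \<le> A + 2"
      if b: "b \<in> tree_exprs G'" for b
    proof -
      obtain b' where b': "b' \<in> tree_exprs G" "b = rename_expr \<pi> b'"
        using b by (auto simp: G'_def tree_exprs_normalize)
      have "set (expr_vars b') \<subseteq> V" using b' by (auto simp: V_def)
      with b' sym[OF b'(1)] len[OF b'(1)] vars show ?thesis
        by (auto simp: expr_vars_rename v_def)
    qed
  qed (simp add: v_def)
  then have "code_tree_scheme (TreeScheme n G') \<le> scheme_bound B m A cs"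
    unfolding code_tree_scheme_def scheme_bound_def Let_def
    using n_le by (intro list_encode_le_list_bound) (auto simp: v_def)
  moreover have "solves (TreeScheme n G') s C"
  proof -
    \<comment> \<open>The renamed variables start with the same values as the original ones.\<close>
    have min: "min (\<pi> i) (n - 1) = min i (n - 1)" for i
      using \<pi>(2,3)[of i] n(2) by (cases "i < n") (auto simp: min_def)
    have "run U G' (\<lambda>i. as ! min i (n - 1)) = probl_value s U as"
      if "U \<in> C" "as \<in> tuples (univ U) n" for U as
    proof -
      have "run U G (\<lambda>i. as ! min i (n - 1)) = probl_value s U as"
        using S(2) that by (simp add: solves_iff G_def n_def)
      then show ?thesis
        using probl_value_less_code[of s U as]
        unfolding G'_def cs_def run_normalize_tree[OF \<pi>(1)] min by simp
    qed
    then show ?thesis by (simp add: solves_iff n_def)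
  qed
  moreover have "TreeScheme n G' \<in> Tree \<sigma>"
    using wf n by (simp add: Tree_def G'_def wf_normalize_tree)
  moreover have "tree_complexity \<psi> (TreeScheme n G') \<le> B"
    using psi by (simp add: tree_complexity_le_iff G'_def path_words_normalize_tree)
  ultimately show ?thesis by (auto simp: cs_def)
qed

section \<open>A computable bound on the codes of optimal trees\<close>

lemma rec_on_list_bound [rec_intros]: "rec_on k P F \<Longrightarrow> rec_on k P G \<Longrightarrow> rec_on k P (\<lambda>xs. list_bound (F xs) (G xs))"
proof (rule rec_on_comp2[of list_bound])
  show "rec2 list_bound"
    unfolding list_bound_def by (intro rec_on_rec_nat rec_intros; simp)
qed

lemma rec_on_tree_bound [rec_intros]:
  "rec_on k P F \<Longrightarrow> rec_on k P G \<Longrightarrow> rec_on k P H \<Longrightarrow> rec_on k P (\<lambda>xs. tree_bound (F xs) (G xs) (H xs))"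
proof (rule rec_on_comp3[of tree_bound])
  show "rec3 tree_bound"
    unfolding tree_bound_def expr_bound_def by (intro rec_on_rec_nat rec_intros; simp)
qed

lemma rec_on_scheme_bound [rec_intros]:
  assumes "rec_on k P F" "rec_on k P G" "rec_on k P H" "rec_on k P I"
  shows "rec_on k P (\<lambda>xs. scheme_bound (F xs) (G xs) (H xs) (I xs))"
  unfolding scheme_bound_def Let_def using assms by (intro rec_intros)

lemma ex_symbol_bound:
  assumes eff: "effective_signature \<sigma>" and sl: "strictly_limited \<sigma> \<psi>"
    and K: "total_recursive (K_psi \<sigma> \<psi>)"
  obtains J where "rec1 J" "\<And>B j. j \<in> syms_eq \<sigma> \<Longrightarrow> \<psi> [j] \<le> B \<Longrightarrow> j < J B"
proof -
  obtain f where f: "\<And>i. finite (omega_psi \<sigma> \<psi> i) \<and> computes f [i] (card (omega_psi \<sigma> \<psi> i))"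
    using K unfolding total_recursive_def K_psi_def by (metis option.distinct(1) option.inject)
  have "rec1 (\<lambda>i. card (omega_psi \<sigma> \<psi> i))"
    by (rule rec_onI[of _ _ f]) (use f in \<open>auto simp: length_Suc_conv\<close>)
  note rec_on_K = rec_on_comp1[OF this]
  define cheap where "cheap B = {j \<in> syms_eq \<sigma>. \<psi> [j] \<le> B}" for B
  have cheap: "cheap B = (\<Union>i\<in>{..<Suc B}. omega_psi \<sigma> \<psi> i)" for B
    by (auto simp: cheap_def omega_psi_def less_Suc_eq_le)
  have fin: "finite (cheap B)" for B using f by (simp add: cheap)
  have card: "card (cheap B) = (\<Sum>i<Suc B. card (omega_psi \<sigma> \<psi> i))" for B
    unfolding cheap using f by (intro card_UN_disjoint) (auto simp: omega_psi_def)
  \<comment> \<open>Counts the symbols of complexity at most \<open>B\<close> among the indices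
    below \<open>n\<close>; the total function \<open>cpsi\<close> replaces \<open>\<psi>\<close> to
    make the count computable.\<close>
  define count where
    "count B n = (\<Sum>j<n. of_bool (j \<in> syms_eq \<sigma> \<and> cpsi \<sigma> \<psi> (ccons j 0) \<le> B) :: nat)" for B n
  have count: "count B n = card (cheap B \<inter> {..<n})" for B n
  proof -
    have "cpsi \<sigma> \<psi> (ccons j 0) = \<psi> [j]" if "j \<in> syms_eq \<sigma>" for j
      using cpsi_list_encode[of "[j]" \<sigma> \<psi>] that by (simp add: ccons_def)
    then have "{..<n} \<inter> {j. j \<in> syms_eq \<sigma> \<and> cpsi \<sigma> \<psi> (ccons j 0) \<le> B} = cheap B \<inter> {..<n}"
      by (auto simp: cheap_def)
    then show ?thesis by (simp add: count_def)
  qed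
  \<comment> \<open>The search stops when the count reaches the total predicted by the values of
    \<open>K_psi\<close> up to \<open>B\<close>.\<close>
  define J where "J B = (LEAST n. count B n = (\<Sum>i<Suc B. card (omega_psi \<sigma> \<psi> i)))" for B
  have ex: "\<exists>n. count B n = (\<Sum>i<Suc B. card (omega_psi \<sigma> \<psi> i))" for B
  proof -
    obtain n where "cheap B \<subseteq> {..<n}" using fin[of B] unfolding finite_nat_set_iff_bounded by blast
    then have "count B n = card (cheap B)" by (simp add: count Int_absorb2)
    then show ?thesis by (auto simp: card)
  qed
  show thesis
  proof
    show "rec1 J"
      unfolding J_def
    proof (rule rec_on_Least)
      show "dec_on (Suc 1) (\<lambda>_. True)
          (\<lambda>ys. count (tl ys ! 0) (hd ys) = (\<Sum>i<Suc (tl ys ! 0). card (omega_psi \<sigma> \<psi> i)))"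
        unfolding count_def by (intro rec_intros rec_on_K rec_on_cpsi eff sl; simp)
    qed (use ex in blast)
    fix B j assume "j \<in> syms_eq \<sigma>" "\<psi> [j] \<le> B"
    then have "j \<in> cheap B" by (simp add: cheap_def)
    \<comment> \<open>A subset of the finite set \<open>cheap B\<close> with the same cardinality is
      all of it, so no cheap symbol lies at or beyond \<open>J B\<close>.\<close>
    moreover have "card (cheap B \<inter> {..<J B}) = card (cheap B)"
      using LeastI_ex[OF ex[of B]] by (simp add: J_def count card)
    then have "cheap B \<inter> {..<J B} = cheap B"
      by (intro card_subset_eq fin) auto
    ultimately show "j < J B" by blast
  qed
qed


lemma ex_scheme_bound:
  assumes eff: "effective_signature \<sigma>" and sl: "strictly_limited \<sigma> \<psi>"
    and K: "total_recursive (K_psi \<sigma> \<psi>)"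
  obtains N where "rec2 N"
    "\<And>B S s C. S \<in> Tree \<sigma> \<Longrightarrow> solves S s (C :: 'a fo_struct set) \<Longrightarrow> tree_complexity \<psi> S \<le> B \<Longrightarrow>
      \<exists>S'\<in>Tree \<sigma>. solves S' s C \<and> tree_complexity \<psi> S' \<le> B \<and>
        code_tree_scheme S' < N B (code_problem_scheme s)"
proof -
  obtain J where J: "rec1 J" "\<And>B j. j \<in> syms_eq \<sigma> \<Longrightarrow> \<psi> [j] \<le> B \<Longrightarrow> j < J B"
    using ex_symbol_bound[OF assms] by blast
  \<comment> \<open>A sum takes the place of a maximum: it dominates every arity and is computable
    by \<open>rec_on_sum\<close>.\<close>
  define A where "A B = (\<Sum>j<J B. if j \<in> syms \<sigma> then arity \<sigma> j else 0)" for B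
  have A: "arity \<sigma> j \<le> A B" if "j \<in> syms \<sigma>" "j < J B" for j B
    using member_le_sum[of j "{..<J B}" "\<lambda>j. if j \<in> syms \<sigma> then arity \<sigma> j else 0"] that
    by (simp add: A_def)
  have "rec1 A"
    unfolding A_def by (intro rec_on_sum rec_on_comp1[OF rec1_arity[OF eff]] rec_on_comp1[OF J(1)] rec_intros) simp_all
  show thesis
  proof
    \<comment> \<open>\<open>Suc\<close> makes the bound strict, as the bounded quantifier over
      codes requires.\<close>
    show "rec2 (\<lambda>B s. Suc (scheme_bound B (J B) (A B) s))"
      by (intro rec_intros rec_on_comp1[OF J(1)] rec_on_comp1[OF \<open>rec1 A\<close>]) simp_all
    show "\<exists>S'\<in>Tree \<sigma>. solves S' s C \<and> tree_complexity \<psi> S' \<le> B \<and>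
        code_tree_scheme S' < Suc (scheme_bound B (J B) (A B) (code_problem_scheme s))"
      if "S \<in> Tree \<sigma>" "solves S s C" "tree_complexity \<psi> S \<le> B" for B S s and C :: "'a fo_struct set"
      using ex_small_solving_tree[OF sl that J(2) A] by (auto simp: less_Suc_eq_le)
  qed
qed

section \<open>The search for an optimal tree\<close>

theorem theorem7:
  fixes \<sigma> :: fo_signature
    and \<psi> :: "nat list \<Rightarrow> nat"
    and C :: "'a fo_struct set"
    and H :: "fm set"
  assumes "effective_signature \<sigma>"
    and "strictly_limited \<sigma> \<psi>"
    and "total_recursive (K_psi \<sigma> \<psi>)"
    and "C \<subseteq> structures \<sigma>" and "C \<noteq> {}"
    and "H \<subseteq> sentences \<sigma>" and "H \<noteq> {}"
    and "solvability_decidable \<sigma> H C"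
  shows "e_optimization_decidable \<sigma> \<psi> H C"
proof -
  obtain f where f: "\<And>\<alpha> s S. \<alpha> \<in> H \<Longrightarrow> s \<in> Probl \<sigma> \<Longrightarrow> S \<in> Tree \<sigma> \<Longrightarrow>
      computes f [code_fm \<alpha>, code_problem_scheme s, code_tree_scheme S]
        (if solves S s (restrict_class C \<alpha>) then 1 else 0)"
    using assms(8) unfolding solvability_decidable_def by blast
  \<comment> \<open>Defined through the algorithm itself and hence on codes only: problem schemes
    that differ in irrelevant values of \<open>\<nu>\<close> share a code.\<close>
  define R where "R a s c \<longleftrightarrow> computes f [a, s, c] 1" for a s c
  have R_iff: "R (code_fm \<alpha>) (code_problem_scheme s) (code_tree_scheme S) \<longleftrightarrow>
      solves S s (restrict_class C \<alpha>)" if "\<alpha> \<in> H" "s \<in> Probl \<sigma>" "S \<in> Tree \<sigma>" for \<alpha> s S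
    using f[OF that] computes_deterministic[OF f[OF that], of 1] unfolding R_def
    by (auto split: if_splits)
  define dom where "dom a s \<longleftrightarrow> a \<in> code_fm ` H \<and> s \<in> code_problem_scheme ` Probl \<sigma>" for a s
  have rec_on_R: "rec_on 3 (\<lambda>xs. dom (xs ! 0) (xs ! 1) \<and> xs ! 2 \<in> code_tree_scheme ` Tree \<sigma>)
      (\<lambda>xs. of_bool (R (xs ! 0) (xs ! 1) (xs ! 2)))"
  proof (rule rec_onI[of _ _ f])
    fix xs :: "nat list"
    assume "length xs = 3" and d: "dom (xs ! 0) (xs ! 1) \<and> xs ! 2 \<in> code_tree_scheme ` Tree \<sigma>"
    then obtain a b c where xs: "xs = [a, b, c]" by (auto simp: numeral_eq_Suc length_Suc_conv)
    from d obtain \<alpha> s S where "\<alpha> \<in> H" "s \<in> Probl \<sigma>" "S \<in> Tree \<sigma>"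
      "a = code_fm \<alpha>" "b = code_problem_scheme s" "c = code_tree_scheme S"
      by (auto simp: xs dom_def)
    with f[of \<alpha> s S] R_iff[of \<alpha> s S] show "computes f xs (of_bool (R (xs ! 0) (xs ! 1) (xs ! 2)))"
      by (simp add: xs of_bool_def)
  qed
  define Q where "Q B a s c \<longleftrightarrow> cheap_code \<sigma> \<psi> B c \<and> R a s c" for B a s c
  have dec_on_Q: "dec_on k P (\<lambda>xs. Q (F xs) (G xs) (H' xs) (I xs))"
    if "rec_on k P F" "rec_on k P G" "rec_on k P H'" "rec_on k P I"
      "\<And>xs. length xs = k \<Longrightarrow> P xs \<Longrightarrow> dom (G xs) (H' xs)" for k P F G H' I
  proof -
    \<comment> \<open>Composition is strict, so the oracle may only be called on codes of trees, even where its
      answer is ignored; \<open>S\<^sub>0\<close> serves as a default.\<close>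
    define S\<^sub>0 where "S\<^sub>0 = TreeScheme 1 (Terminal 0)"
    let ?g = "\<lambda>xs. if cheap_code \<sigma> \<psi> (F xs) (I xs) then I xs else code_tree_scheme S\<^sub>0"
    have "S\<^sub>0 \<in> Tree \<sigma>" by (simp add: S\<^sub>0_def Tree_def)
    then have g: "?g xs \<in> code_tree_scheme ` Tree \<sigma>" for xs by (auto simp: cheap_code_def)
    note cheap = dec_on_cheap_code[OF assms(1,2)]
    have "rec_on k P (\<lambda>xs. (\<lambda>ys. of_bool (R (ys ! 0) (ys ! 1) (ys ! 2))) (map (\<lambda>F. F xs) [G, H', ?g]))"
      using that g by (intro rec_on_comp[OF rec_on_R]) (auto intro!: rec_intros cheap)
    then have "dec_on k P (\<lambda>xs. R (G xs) (H' xs) (?g xs))" by (simp add: dec_on_def)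
    with that have "dec_on k P (\<lambda>xs. cheap_code \<sigma> \<psi> (F xs) (I xs) \<and> R (G xs) (H' xs) (?g xs))"
      by (intro dec_on_conj cheap)
    then show ?thesis
      unfolding dec_on_def by (rule rec_on_cong) (auto simp: Q_def)
  qed
  have Q_iff: "Q B (code_fm \<alpha>) (code_problem_scheme s) c \<longleftrightarrow>
      (\<exists>S\<in>Tree \<sigma>. c = code_tree_scheme S \<and> tree_complexity \<psi> S \<le> B \<and> solves S s (restrict_class C \<alpha>))"
    if "\<alpha> \<in> H" "s \<in> Probl \<sigma>" for B \<alpha> s c
    using R_iff[OF that] by (auto simp: Q_def cheap_code_def)
  obtain N where N: "rec2 N"
    "\<And>B S s D. S \<in> Tree \<sigma> \<Longrightarrow> solves S s (D :: 'a fo_struct set) \<Longrightarrow> tree_complexity \<psi> S \<le> B \<Longrightarrow>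
      \<exists>S'\<in>Tree \<sigma>. solves S' s D \<and> tree_complexity \<psi> S' \<le> B \<and>
        code_tree_scheme S' < N B (code_problem_scheme s)"
    using ex_scheme_bound[OF assms(1-3)] by blast
  \<comment> \<open>Any solving tree yields one of no greater complexity with a code below
    \<open>N\<close>, so bounding the codes excludes no attainable complexity.\<close>
  have Q_below: "\<exists>c<N (tree_complexity \<psi> S) (code_problem_scheme s).
      Q (tree_complexity \<psi> S) (code_fm \<alpha>) (code_problem_scheme s) c"
    if "\<alpha> \<in> H" "s \<in> Probl \<sigma>" "S \<in> Tree \<sigma>" "solves S s (restrict_class C \<alpha>)" for \<alpha> s S
    using N(2)[OF that(3,4) order_refl] by (auto simp: Q_iff[OF that(1,2)])
  \<comment> \<open>The bound on \<open>c\<close> makes the test for each \<open>B\<close> halt; an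
    unbounded search for \<open>c\<close> would never end if \<open>B\<close> is too small.\<close>
  define opt where "opt a s = (LEAST B. \<exists>c<N B s. Q B a s c)" for a s
  have ex: "\<exists>B. \<exists>c<N B s. Q B a s c" if "dom a s" for a s
    using that ex_solving_tree Q_below unfolding dom_def by blast
  have rec_on_opt: "rec_on 2 (\<lambda>xs. dom (xs ! 0) (xs ! 1)) (\<lambda>xs. opt (xs ! 0) (xs ! 1))"
    unfolding opt_def
    by (rule rec_on_Least) (use ex in \<open>auto intro!: dec_on_ex_less dec_on_Q rec_on_comp2[OF N(1)] rec_intros\<close>)
  \<comment> \<open>Once a bound is known to be attained, an unbounded search finds the code; the
    guard provides its termination.\<close>
  have rec_on_tree: "rec_on 3 (\<lambda>xs. dom (xs ! 1) (xs ! 2) \<and> (\<exists>c. Q (xs ! 0) (xs ! 1) (xs ! 2) c))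
      (\<lambda>xs. LEAST c. Q (xs ! 0) (xs ! 1) (xs ! 2) c)"
    by (rule rec_on_Least) (auto intro!: dec_on_Q rec_intros)
  have Q_opt: "\<exists>c. Q (opt a s) a s c" if "dom a s" for a s
    using LeastI_ex[OF ex[OF that]] unfolding opt_def by blast
  have "rec_on 2 (\<lambda>xs. dom (xs ! 0) (xs ! 1))
      (\<lambda>xs. (\<lambda>ys. LEAST c. Q (ys ! 0) (ys ! 1) (ys ! 2) c)
        (map (\<lambda>F. F xs) [\<lambda>xs. opt (xs ! 0) (xs ! 1), \<lambda>xs. xs ! 0, \<lambda>xs. xs ! 1]))"
    by (rule rec_on_comp[OF rec_on_tree]) (use Q_opt rec_on_opt in \<open>auto intro!: rec_on_nth\<close>)
  then obtain g where g: "\<And>xs. length xs = 2 \<Longrightarrow> dom (xs ! 0) (xs ! 1) \<Longrightarrow>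
      computes g xs (LEAST c. Q (opt (xs ! 0) (xs ! 1)) (xs ! 0) (xs ! 1) c)"
    by (auto simp: rec_on_def)
  show ?thesis
    unfolding e_optimization_decidable_def
  proof (intro exI[of _ g] ballI)
    fix \<alpha> s assume \<alpha>: "\<alpha> \<in> H" and s: "s \<in> Probl \<sigma>"
    let ?a = "code_fm \<alpha>" and ?s = "code_problem_scheme s"
    have d: "dom ?a ?s" using \<alpha> s by (simp add: dom_def)
    obtain S where S: "(LEAST c. Q (opt ?a ?s) ?a ?s c) = code_tree_scheme S" "S \<in> Tree \<sigma>"
      "tree_complexity \<psi> S \<le> opt ?a ?s" "solves S s (restrict_class C \<alpha>)"
      using LeastI_ex[OF Q_opt[OF d]] Q_iff[OF \<alpha> s] by blast
    \<comment> \<open>A competitor \<open>S'\<close> makes its own complexity pass the test, so the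
      least bound cannot exceed it.\<close>
    have "opt ?a ?s \<le> tree_complexity \<psi> S'" if "S' \<in> Tree \<sigma>" "solves S' s (restrict_class C \<alpha>)" for S'
      unfolding opt_def by (rule Least_le) (rule Q_below[OF \<alpha> s that])
    with S have "e_optimal \<sigma> \<psi> (restrict_class C \<alpha>) s S"
      unfolding e_optimal_def using le_trans by blast
    with S(1) g[of "[?a, ?s]"] d
    show "\<exists>S. computes g [code_fm \<alpha>, code_problem_scheme s] (code_tree_scheme S) \<and>
        e_optimal \<sigma> \<psi> (restrict_class C \<alpha>) s S"
      by auto
  qed
qed

end
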